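(* Let $n\ge 13$. The minimum number of queries in a non-adaptive algorithm that finds a pair of vertices at maximum distance in a hidden tree on $n$ vertices is $\frac{n(n-3)}{2}$, and the same holds for determining the hidden tree up to isomorphism. Moreover, for a query graph $Q$ on the $n$-element vertex set $V$, the following are equivalent: (i) $Q$ finds a pair of vertices at maximum distance; (ii) $Q$ determines the hidden tree up to isomorphism; (iii) every vertex of $Q$ has degree at least $n-3$.
   Context: A tree $T$ is hidden on a known vertex set $V$, $|V|=n$. A distance query is an unordered pair of distinct vertices, answered by their distance in $T$. A non-adaptive algorithm is a set $Q$ of queried pairs (the query graph on $V$) fixed in advance. A tree on $V$ is consistent if its distance between every pair in $Q$ equals the answer. $Q$ finds a pair of vertices at maximum distance if for every hidden tree $T$ there are vertices $x,y$ whose distance equals the diameter in every tree consistent with the answers of $T$ on $Q$. $Q$ determines the hidden tree up to isomorphism if for every hidden tree $T$ all trees consistent with the answers of $T$ on $Q$ are isomorphic. *)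

theory Defs
  imports "HOL-Library.Ramsey"
begin

text \<open>
  A simple graph is a vertex set together with an edge set \<open>E \<subseteq> [V]\<^bsup>2\<^esup>\<close>.
  Walks are represented by their nonempty vertex lists, so the length of the walk \<open>p\<close>
  is \<open>length p - 1\<close>.
\<close>

definition walk_betw :: "'a set \<Rightarrow> 'a set set \<Rightarrow> 'a \<Rightarrow> 'a list \<Rightarrow> 'a \<Rightarrow> bool" where
  "walk_betw V E u p v \<longleftrightarrow>
     p \<noteq> [] \<and> set p \<subseteq> V \<and> hd p = u \<and> last p = v \<and> successively (\<lambda>x y. {x, y} \<in> E) p"

definition graph_connected :: "'a set \<Rightarrow> 'a set set \<Rightarrow> bool" where
  "graph_connected V E \<longleftrightarrow> (\<forall>u\<in>V. \<forall>v\<in>V. \<exists>p. walk_betw V E u p v)"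

definition graph_cycle :: "'a set \<Rightarrow> 'a set set \<Rightarrow> 'a list \<Rightarrow> bool" where
  "graph_cycle V E p \<longleftrightarrow>
     3 \<le> length p \<and> distinct p \<and> walk_betw V E (hd p) p (last p) \<and> {last p, hd p} \<in> E"

definition is_tree :: "'a set \<Rightarrow> 'a set set \<Rightarrow> bool" where
  "is_tree V E \<longleftrightarrow>
     V \<noteq> {} \<and> E \<subseteq> [V]\<^bsup>2\<^esup> \<and> graph_connected V E \<and> (\<nexists>p. graph_cycle V E p)"

definition graph_dist :: "'a set \<Rightarrow> 'a set set \<Rightarrow> 'a \<Rightarrow> 'a \<Rightarrow> nat" where
  "graph_dist V E u v = (LEAST k. \<exists>p. walk_betw V E u p v \<and> length p = Suc k)"

definition graph_diam :: "'a set \<Rightarrow> 'a set set \<Rightarrow> nat" where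
  "graph_diam V E = Max {graph_dist V E u v | u v. u \<in> V \<and> v \<in> V}"

definition graph_iso :: "'a set \<Rightarrow> 'a set set \<Rightarrow> 'b set \<Rightarrow> 'b set set \<Rightarrow> bool" where
  "graph_iso V E W F \<longleftrightarrow>
     (\<exists>f. bij_betw f V W \<and> (\<forall>u\<in>V. \<forall>v\<in>V. {u, v} \<in> E \<longleftrightarrow> {f u, f v} \<in> F))"

definition graph_degree :: "'a set set \<Rightarrow> 'a \<Rightarrow> nat" where
  "graph_degree E v = card {e \<in> E. v \<in> e}"

definition query_graph :: "'a set \<Rightarrow> 'a set set \<Rightarrow> bool" where
  "query_graph V Q \<longleftrightarrow> Q \<subseteq> [V]\<^bsup>2\<^esup>"

text \<open>The tree \<open>T'\<close> is consistent with the answers given by the hidden tree \<open>T\<close> on \<open>Q\<close>.\<close>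

definition consistent :: "'a set \<Rightarrow> 'a set set \<Rightarrow> 'a set set \<Rightarrow> 'a set set \<Rightarrow> bool" where
  "consistent V Q T T' \<longleftrightarrow>
     is_tree V T' \<and> (\<forall>u v. {u, v} \<in> Q \<longrightarrow> graph_dist V T' u v = graph_dist V T u v)"

definition finds_diametral_pair :: "'a set \<Rightarrow> 'a set set \<Rightarrow> bool" where
  "finds_diametral_pair V Q \<longleftrightarrow>
     (\<forall>T. is_tree V T \<longrightarrow>
        (\<exists>x\<in>V. \<exists>y\<in>V. \<forall>T'. consistent V Q T T' \<longrightarrow> graph_dist V T' x y = graph_diam V T'))"

definition determines_tree_up_to_iso :: "'a set \<Rightarrow> 'a set set \<Rightarrow> bool" where
  "determines_tree_up_to_iso V Q \<longleftrightarrow>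
     (\<forall>T. is_tree V T \<longrightarrow>
        (\<forall>T' T''. consistent V Q T T' \<and> consistent V Q T T'' \<longrightarrow> graph_iso V T' V T''))"

definition is_min_queries :: "'a set \<Rightarrow> ('a set \<Rightarrow> 'a set set \<Rightarrow> bool) \<Rightarrow> nat \<Rightarrow> bool" where
  "is_min_queries V P k \<longleftrightarrow>
     (\<exists>Q. query_graph V Q \<and> P V Q \<and> card Q = k) \<and>
     (\<forall>Q. query_graph V Q \<and> P V Q \<longrightarrow> k \<le> card Q)"

end

theory Submission
  imports Defs
begin

text \<open>
  Sufficiency. Two trees that agree on all queries give two integral tree metrics \<open>d\<close>, \<open>e\<close> on \<open>V\<close>
  whose disagreement graph has maximum degree 2. If \<open>d u v \<noteq> e u v\<close>, the four-point condition forces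
  \<open>d u x - d v x\<close> to be constant for all but at most two further vertices \<open>x\<close>, so that few vertices
  can lie between \<open>u\<close> and \<open>v\<close> and \<open>{d u v, e u v}\<close> is \<open>{1, 3}\<close> or \<open>{2, 4}\<close>; a pair of the first
  kind always exists. For such a pair, up to symmetry, \<open>v\<close> hangs from a vertex \<open>b\<close> in one tree and
  from \<open>u\<close> in the other, where \<open>u\<close> and \<open>b\<close> have a common neighbour. Exchanging \<open>u\<close> and \<open>b\<close> in
  one tree repairs \<open>v\<close>, and although it may create new disagreements, the disagreement graph still
  has maximum degree 2 and fewer non-isolated vertices. Iterating yields an isomorphism. Moreover, a
  pair whose distance can shrink is never farther apart than all queried pairs, so a queried
  diametral pair exists or every diametral pair is stable.

  Necessity. If \<open>c\<close> is not queried against \<open>a1\<close>, \<open>a2\<close>, \<open>a3\<close>, take a star in which \<open>a3\<close> is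
  hung from the leaf \<open>a2\<close>, and hang \<open>c\<close> from \<open>a1\<close> or from \<open>a2\<close>: the answers are the same,
  but the diameter is 4 in the first case, attained only by \<open>c\<close> and \<open>a3\<close>, and 3 in the second.
\<close>

subsection \<open>Tree metrics that differ on a graph of maximum degree two\<close>

text \<open>Integral tree metrics: \<open>parity\<close> reflects that trees are bipartite,
  \<open>between\<close> that geodesics run through vertices, and \<open>four_point\<close>, taken
  over all pairings of four vertices, that the two largest of the three pair sums coincide. In terms
  of distance functions, relabelling a tree is mere composition.\<close>

locale tree_metric =
  fixes V :: "'a set" and d :: "'a \<Rightarrow> 'a \<Rightarrow> nat"
  assumes zero_iff: "x \<in> V \<Longrightarrow> y \<in> V \<Longrightarrow> d x y = 0 \<longleftrightarrow> x = y"
    and sym: "x \<in> V \<Longrightarrow> y \<in> V \<Longrightarrow> d x y = d y x"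
    and triangle: "x \<in> V \<Longrightarrow> y \<in> V \<Longrightarrow> z \<in> V \<Longrightarrow> d x z \<le> d x y + d y z"
    and parity: "x \<in> V \<Longrightarrow> y \<in> V \<Longrightarrow> z \<in> V \<Longrightarrow> even (d x y + d y z + d x z)"
    and between: "x \<in> V \<Longrightarrow> y \<in> V \<Longrightarrow> i \<le> d x y \<Longrightarrow>
      \<exists>z\<in>V. d x z = i \<and> d z y = d x y - i"
    and four_point: "x \<in> V \<Longrightarrow> y \<in> V \<Longrightarrow> z \<in> V \<Longrightarrow> w \<in> V \<Longrightarrow>
      d x y + d z w \<le> d x z + d y w \<or> d x y + d z w \<le> d x w + d y z"

abbreviation exchange :: "'a \<Rightarrow> 'a \<Rightarrow> 'a \<Rightarrow> 'a" where
  "exchange a b \<equiv> id(a := b, b := a)"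

lemma (in tree_metric) permute:
  assumes bij: "bij_betw \<sigma> V V"
  shows "tree_metric V (\<lambda>x y. d (\<sigma> x) (\<sigma> y))"
proof -
  have V: "\<sigma> x \<in> V" if "x \<in> V" for x using bij that by (auto simp: bij_betw_def)
  have inj: "\<sigma> x = \<sigma> y \<longleftrightarrow> x = y" if "x \<in> V" "y \<in> V" for x y
    using bij that by (auto simp: bij_betw_def inj_on_def)
  have surj: "\<exists>x\<in>V. z = \<sigma> x" if "z \<in> V" for z using bij that by (auto simp: bij_betw_def)
  show ?thesis
  proof
    fix x y i assume "x \<in> V" "y \<in> V" "i \<le> d (\<sigma> x) (\<sigma> y)"
    then show "\<exists>z\<in>V. d (\<sigma> x) (\<sigma> z) = i \<and> d (\<sigma> z) (\<sigma> y) = d (\<sigma> x) (\<sigma> y) - i"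
      using between[of "\<sigma> x" "\<sigma> y" i] surj V by metis
  next
    fix x y z assume "x \<in> V" "y \<in> V" "z \<in> V"
    then show "even (d (\<sigma> x) (\<sigma> y) + d (\<sigma> y) (\<sigma> z) + d (\<sigma> x) (\<sigma> z))"
      by (intro parity V)
  qed (use V inj in \<open>simp_all add: zero_iff triangle four_point\<close>, simp add: sym V)
qed

locale tree_metric_pair = A: tree_metric V d + B: tree_metric V e
  for V :: "'a set" and d e :: "'a \<Rightarrow> 'a \<Rightarrow> nat" +
  assumes finite_V: "finite V" and large: "13 \<le> card V"
    and degree: "u \<in> V \<Longrightarrow> card {x \<in> V. d u x \<noteq> e u x} \<le> 2"
begin

section \<open>Disagreements and common unchanged vertices\<close>

definition changed :: "'a \<Rightarrow> 'a set" where "changed u = {x \<in> V. d u x \<noteq> e u x}"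

text \<open>The common witnesses of the pair: outside vertices whose distances to both ends are the
  same in the two metrics.\<close>

definition rest :: "'a \<Rightarrow> 'a \<Rightarrow> 'a set" where "rest u v = V - ({u, v} \<union> changed u \<union> changed v)"

text \<open>Transfers what is shown for distances larger in \<open>d\<close> to distances larger in
  \<open>e\<close>.\<close>

lemma swapped: "tree_metric_pair V e d"
proof (unfold_locales, goal_cases)
  case (3 u)
  have "{x \<in> V. e u x \<noteq> d u x} = {x \<in> V. d u x \<noteq> e u x}" by auto
  then show ?case using degree[OF 3] by simp
qed (use finite_V large in auto)

lemma finite_changed [simp]: "finite (changed u)"
  using finite_V by (simp add: changed_def)

lemma card_changed: "u \<in> V \<Longrightarrow> card (changed u) \<le> 2"
  using degree by (simp add: changed_def)

lemma changed_sym: "u \<in> V \<Longrightarrow> v \<in> V \<Longrightarrow> u \<in> changed v \<longleftrightarrow> v \<in> changed u"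
  using A.sym B.sym by (simp add: changed_def)

lemma rest_commute: "rest u v = rest v u"
  by (auto simp: rest_def)

lemma restD:
  assumes "x \<in> rest u v"
  shows "x \<in> V" "x \<noteq> u" "x \<noteq> v" "e u x = d u x" "e v x = d v x"
  using assms by (auto simp: rest_def changed_def)

lemma changed_cover:
  assumes "u \<in> V" "v \<in> changed u"
  obtains u' where "changed u \<subseteq> {v, u'}"
proof -
  have "card (changed u - {v}) \<le> 1" using card_changed[OF assms(1)] assms(2) by simp
  then obtain u' where "changed u - {v} \<subseteq> {u'}"
    by (metis card_le_Suc0_iff_eq finite_Diff finite_changed One_nat_def insertI1 subsetI)
  then show ?thesis using that by blast
qed

lemma rest_cover:
  assumes "u \<in> V" "v \<in> changed u"
  obtains u' v' where "changed u \<subseteq> {v, u'}" "changed v \<subseteq> {u, v'}" "V - {u, v, u', v'} \<subseteq> rest u v"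
proof -
  have "v \<in> V" "u \<in> changed v" using assms changed_sym by (auto simp: changed_def)
  then obtain u' v' where "changed u \<subseteq> {v, u'}" "changed v \<subseteq> {u, v'}"
    using changed_cover assms by metis
  then show ?thesis by (intro that[of u' v']) (auto simp: rest_def)
qed

text \<open>Besides \<open>u\<close> and \<open>v\<close>, each end excludes at most one further
  vertex, so 13 - 4 = 9 vertices remain.\<close>

lemma card_rest:
  assumes "u \<in> V" "v \<in> changed u"
  shows "9 \<le> card (rest u v)"
proof -
  obtain u' v' where "V - {u, v, u', v'} \<subseteq> rest u v" using rest_cover assms by metis
  moreover have "finite (rest u v)" using finite_V by (simp add: rest_def)
  ultimately have "card (V - {u, v, u', v'}) \<le> card (rest u v)" by (simp add: card_mono)
  moreover have "card V - card {u, v, u', v'} \<le> card (V - {u, v, u', v'})"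
    by (rule diff_card_le_card_Diff) simp
  moreover have "card {u, v, u', v'} \<le> 4"
    by (simp add: card_insert_if)
  ultimately show ?thesis using large by linarith
qed

section \<open>Constant offsets at a changed pair\<close>

lemma rest_avoid:
  assumes "u \<in> V" "v \<in> changed u" "finite S" "card S \<le> 8"
  obtains x where "x \<in> rest u v" "x \<notin> S"
proof -
  have "\<not> rest u v \<subseteq> S"
    using card_mono[OF assms(3), of "rest u v"] card_rest[OF assms(1,2)] assms(4) by linarith
  then show ?thesis using that by blast
qed

text \<open>Of \<open>d u v + d x y\<close>, \<open>d u x + d v y\<close> and
  \<open>d u y + d v x\<close> the two largest coincide, and likewise for \<open>e\<close>. If
  \<open>x y\<close> is unchanged, only the first sum differs between the metrics. Were the other
  two distinct, the first would be their maximum in both metrics, forcing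
  \<open>d u v = e u v\<close>.\<close>

lemma rest_exchange:
  assumes "u \<in> V" "v \<in> changed u" "x \<in> rest u v" "y \<in> rest u v"
  shows "d u x + d v y = d u y + d v x"
proof -
  have direct: "d u x + d v y = d u y + d v x"
    if "x \<in> rest u v" "y \<in> rest u v" "e x y = d x y" for x y
  proof -
    have V: "u \<in> V" "v \<in> V" "x \<in> V" "y \<in> V"
      using assms that by (auto simp: changed_def rest_def)
    have ne: "d u v \<noteq> e u v" using assms by (simp add: changed_def)
    have largest: "a + b = max s t"
      if "a + b \<le> s \<or> a + b \<le> t" "s \<le> a + b \<or> s \<le> t" "t \<le> a + b \<or> t \<le> s" "s \<noteq> t"
      for a b s t :: nat using that by linarith
    have sums: "s = t"
      if "a + b \<le> s \<or> a + b \<le> t" "s \<le> a + b \<or> s \<le> t" "t \<le> a + b \<or> t \<le> s"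
        "a' + b \<le> s \<or> a' + b \<le> t" "s \<le> a' + b \<or> s \<le> t" "t \<le> a' + b \<or> t \<le> s" "a \<noteq> a'"
      for a b a' s t :: nat
      using largest[OF that(1-3)] largest[OF that(4-6)] that(7) by fastforce
    note eqs = A.sym[OF V(3,2)] A.sym[OF V(4,2)] A.sym[OF V(4,3)] B.sym[OF V(4,3)]
      B.sym[OF V(3,2)] B.sym[OF V(4,2)] that(3) restD(4,5)[OF that(1)] restD(4,5)[OF that(2)]
    show ?thesis
      by (rule sums[of "d u v" "d x y" _ _ "e u v"])
        (use ne A.four_point[OF V] A.four_point[OF V(1,3,2,4)] A.four_point[OF V(1,4,2,3)]
          B.four_point[OF V] B.four_point[OF V(1,3,2,4)] B.four_point[OF V(1,4,2,3)]
          in \<open>simp_all add: eqs ac_simps\<close>)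
  qed
  have V: "x \<in> V" "y \<in> V" using assms by (auto simp: rest_def)
  \<comment> \<open>If \<open>x y\<close> itself may be changed, both are compared with a witness
    \<open>z\<close> unchanged to each; the terms in \<open>z\<close> cancel.\<close>
  have "card (changed x \<union> changed y) \<le> 8"
    using card_Un_le[of "changed x" "changed y"] card_changed[OF V(1)] card_changed[OF V(2)] by linarith
  then obtain z where z: "z \<in> rest u v" "z \<notin> changed x \<union> changed y"
    using rest_avoid[of u v "changed x \<union> changed y"] assms by auto
  have "e x z = d x z" "e y z = d y z" using z by (auto simp: changed_def rest_def)
  then show ?thesis using direct[of x z] direct[of y z] assms z by linarith
qed

lemma rest_offset:
  assumes "u \<in> V" "v \<in> changed u"
  obtains c :: int where "\<And>x. x \<in> rest u v \<Longrightarrow> int (d u x) = int (d v x) + c"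
proof -
  obtain z where "z \<in> rest u v" using rest_avoid[OF assms, of "{}"] by auto
  then have "int (d u x) = int (d v x) + (int (d u z) - int (d v z))" if "x \<in> rest u v" for x
    using rest_exchange[OF assms that, of z] by linarith
  then show ?thesis by (rule that)
qed

text \<open>Both distances have the parity of \<open>d u x + d v x\<close> for any common witness
  \<open>x\<close>.\<close>

lemma same_parity:
  assumes "u \<in> V" "v \<in> changed u"
  shows "even (d u v + e u v)"
proof -
  obtain x where x: "x \<in> rest u v" using rest_avoid[OF assms, of "{}"] by auto
  have V: "v \<in> V" "x \<in> V" using assms x by (auto simp: changed_def rest_def)
  show ?thesis
    using A.parity[OF assms(1) V] B.parity[OF assms(1) V] restD[OF x] by presburger
qed

text \<open>Along a \<open>d\<close>-geodesic from \<open>u\<close> to \<open>v\<close> the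
  difference of the distances to \<open>u\<close> and \<open>v\<close> is different at each vertex,
  whereas it is constant on \<open>rest u v\<close>. So at most one inner vertex lies in
  \<open>rest u v\<close>, and the others are among \<open>u'\<close> and \<open>v'\<close>; four
  inner vertices are too many. Parity leaves the two cases.\<close>

lemma changed_cases:
  assumes "u \<in> V" "v \<in> V" "e u v < d u v"
  shows "d u v = 3 \<and> e u v = 1 \<or> d u v = 4 \<and> e u v = 2"
proof -
  have vN: "v \<in> changed u" using assms by (auto simp: changed_def)
  obtain c where c: "\<And>x. x \<in> rest u v \<Longrightarrow> int (d u x) = int (d v x) + c"
    using rest_offset[OF assms(1) vN] by blast
  obtain u' v' where u'v': "V - {u, v, u', v'} \<subseteq> rest u v"
    using rest_cover[OF assms(1) vN] by metis
  have "e u v \<noteq> 0" using assms A.zero_iff[of u v] B.zero_iff[of u v] by force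
  moreover have "d u v \<ge> e u v + 2" using same_parity[OF assms(1) vN] assms(3) by presburger
  moreover have "\<not> 5 \<le> d u v"
  proof
    assume "5 \<le> d u v"
    have "\<exists>z. z \<in> V \<and> d u z = i \<and> d z v = d u v - i" if "i \<le> 4" for i
      using A.between[OF assms(1,2), of i] that \<open>5 \<le> d u v\<close> by auto
    then obtain p where p: "\<And>i. i \<le> 4 \<Longrightarrow> p i \<in> V \<and> d u (p i) = i \<and> d (p i) v = d u v - i"
      by metis
    have pv: "d v (p i) = d u v - i" if "i \<le> 4" for i
      using p[OF that] A.sym assms(2) by metis
    have cW: "int i = int (d u v) - int i + c" if "i \<le> 4" "p i \<in> rest u v" for i
      using c[OF that(2)] p[OF that(1)] pv[OF that(1)] \<open>5 \<le> d u v\<close> that(1) by auto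
    have out: "p i \<in> {u', v'}" if "1 \<le> i" "i \<le> 4" "p i \<notin> rest u v" for i
    proof -
      have "p i \<noteq> u" using p[OF that(2)] that A.zero_iff assms(1) by (metis not_one_le_zero)
      moreover have "p i \<noteq> v" using p[OF that(2)] pv[OF that(2)] \<open>5 \<le> d u v\<close> that
          A.zero_iff[OF assms(2,2)] by auto
      ultimately show ?thesis using u'v' p[OF that(2)] that(3) by blast
    qed
    have inj: "p i \<noteq> p j" if "i \<le> 4" "j \<le> 4" "i \<noteq> j" for i j
      using p that by metis
    have uniq: "\<not> (p i \<in> rest u v \<and> p j \<in> rest u v)" if "i \<le> 4" "j \<le> 4" "i \<noteq> j" for i j
      using cW[of i] cW[of j] that by auto
    define I where "I = {i \<in> {1..4}. p i \<notin> rest u v}"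
    have "inj_on p I" by (auto simp: inj_on_def I_def dest: inj)
    moreover have "p ` I \<subseteq> {u', v'}" using out by (force simp: I_def)
    ultimately have "card I \<le> card {u', v'}" by (metis card_inj_on_le finite.emptyI finite_insert)
    then have I: "card I \<le> 2" by (simp add: card_insert_if split: if_splits)
    have "card ({1..4} - I) \<le> Suc 0"
    proof (subst card_le_Suc0_iff_eq; (intro ballI)?)
      fix i j assume "i \<in> {1..4} - I" "j \<in> {1..4} - I"
      then show "i = j" using uniq[of i j] by (force simp: I_def)
    qed simp
    moreover have "card {1..4::nat} - card I \<le> card ({1..4} - I)"
      by (rule diff_card_le_card_Diff) (simp add: I_def)
    ultimately show False using I by simp
  qed
  ultimately show ?thesis using same_parity[OF assms(1) vN] by presburger
qed

section \<open>Pairs at distance 4 in one metric and 2 in the other\<close>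

lemma four_two_middle:
  assumes "u \<in> V" "v \<in> V" "d u v = 4" "e u v = 2"
  obtains u' v' q where "changed u \<subseteq> {v, u'}" "changed v \<subseteq> {u, v'}" "V - {u, v, u', v'} \<subseteq> rest u v"
    "q \<in> V" "e u q = 1" "e v q = 1" "q = u' \<or> q = v'"
proof -
  have vN: "v \<in> changed u" using assms by (simp add: changed_def)
  obtain u' v' where u'v': "changed u \<subseteq> {v, u'}" "changed v \<subseteq> {u, v'}" "V - {u, v, u', v'} \<subseteq> rest u v"
    using rest_cover[OF assms(1) vN] by metis
  obtain q where q: "q \<in> V" "e u q = 1" "e q v = 1"
    using B.between[OF assms(1,2), of 1] assms by auto
  have q': "e v q = 1" using q B.sym assms by metis
  \<comment> \<open>A middle vertex with both distances unchanged would give \<open>d u v\<close> at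
    most 2.\<close>
  have "q \<notin> rest u v"
    using restD(4,5)[of q u v] q q' A.triangle[OF assms(1) q(1) assms(2)] A.sym[OF q(1) assms(2)]
      assms(3) by auto
  moreover have "q \<noteq> u" "q \<noteq> v" using q q' B.zero_iff assms(1,2) by force+
  ultimately show ?thesis using that u'v' q q' by blast
qed

text \<open>The \<open>d\<close>-geodesic vertices at distance 1 and 2 from \<open>u\<close> have
  offsets -2 and 0 instead of 2, so they are \<open>u'\<close> and \<open>v'\<close> in some order,
  and the middle vertex \<open>q\<close> of \<open>e\<close> is one of them. The unchanged distances
  allow only \<open>q = p1 = v'\<close>, and then \<open>v\<close> and \<open>p1\<close> form the
  required pair.\<close>

lemma four_two_offset_two:
  assumes "u \<in> V" "v \<in> V" "d u v = 4" "e u v = 2"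
    and offset: "\<And>x. x \<in> rest u v \<Longrightarrow> d u x = d v x + 2"
  shows "\<exists>a\<in>V. \<exists>b\<in>V. d a b = 3 \<and> e a b = 1"
proof -
  obtain u' v' q where *: "changed u \<subseteq> {v, u'}" "changed v \<subseteq> {u, v'}" "V - {u, v, u', v'} \<subseteq> rest u v"
    and q: "q \<in> V" "e u q = 1" "e v q = 1" "q = u' \<or> q = v'"
    using four_two_middle[OF assms(1-4)] by metis
  obtain p1 where p1: "p1 \<in> V" "d u p1 = 1" "d p1 v = 3"
    using A.between[OF assms(1,2), of 1] assms(3) by auto
  obtain p2 where p2: "p2 \<in> V" "d u p2 = 2" "d p2 v = 2"
    using A.between[OF assms(1,2), of 2] assms(3) by auto
  have p: "d v p1 = 3" "d v p2 = 2" using p1 p2 A.sym assms by metis+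
  have "p1 \<noteq> u" "p1 \<noteq> v" "p2 \<noteq> u" "p2 \<noteq> v" "p1 \<noteq> p2"
    using p1 p2 p A.zero_iff[OF assms(1,1)] A.zero_iff[OF assms(2,2)] by auto
  moreover have "p1 \<notin> rest u v" "p2 \<notin> rest u v" using offset p1 p2 p by force+
  ultimately have split: "p1 = u' \<and> p2 = v' \<or> p1 = v' \<and> p2 = u'" using *(3) p1 p2 by blast
  have unchanged: "e w x = d w x" if "x \<in> V" "x \<notin> changed w" for w x using that by (simp add: changed_def)
  show ?thesis
  proof (cases "p1 = u'")
    case True
    \<comment> \<open>In this case each candidate for \<open>q\<close> keeps a distance above 1 to
      one of the ends.\<close>
    then have "p1 \<notin> changed v" "p2 \<notin> changed u"
      using split \<open>p1 \<noteq> p2\<close> \<open>p1 \<noteq> u\<close> \<open>p2 \<noteq> v\<close> * by auto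
    then have "e v p1 = 3" "e u p2 = 2" using unchanged p1 p2 p by auto
    then show ?thesis using q True split \<open>p1 \<noteq> p2\<close> by auto
  next
    case False
    then have "p1 = v'" "p2 = u'" using split by auto
    then have "p2 \<notin> changed v" using \<open>p1 \<noteq> p2\<close> \<open>p2 \<noteq> u\<close> * by auto
    then have "e v p2 = 2" using unchanged p2 p by auto
    then have "q = p1" using q \<open>p1 = v'\<close> \<open>p2 = u'\<close> by auto
    then show ?thesis using p p1 q assms(2) by auto
  qed
qed

text \<open>The \<open>d\<close>-geodesic vertices at distance 1 and 3 from \<open>u\<close> violate
  offset 0, so they are \<open>u'\<close> and \<open>v'\<close>. In one order neither can be the
  middle vertex \<open>q\<close> of \<open>e\<close>; in the other, each stays adjacent to its end
  of the geodesic, and \<open>crossed\<close> applies at \<open>u\<close> or at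
  \<open>v\<close>.\<close>

lemma four_two_offset_zero:
  assumes "u \<in> V" "v \<in> V" "d u v = 4" "e u v = 2"
    and offset: "\<And>x. x \<in> rest u v \<Longrightarrow> d u x = d v x"
  shows False
proof -
  \<comment> \<open>In \<open>e\<close>, the distinct vertices \<open>p\<close> and \<open>q\<close>
    would both be neighbours of \<open>u\<close> closer to \<open>x\<close> than \<open>u\<close>
    is; a tree has only one such neighbour.\<close>
  have crossed: False
    if uv: "u \<in> V" "v \<in> V" "d u v = 4" "e u v = 2"
      and offset: "\<And>x. x \<in> rest u v \<Longrightarrow> d u x = d v x"
      and p: "p \<in> V" "p \<noteq> q" "d u p = 1" "d v p = 3" "e u p = 1"
      and q: "q \<in> V" "e u q = 1" "e v q = 1" for u v p q
  proof -
    have vN: "v \<in> changed u" using uv by (simp add: changed_def)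
    obtain x where x: "x \<in> rest u v" "x \<notin> changed p"
      using rest_avoid[OF uv(1) vN, of "changed p"] card_changed[OF p(1)] by auto
    have xV: "x \<in> V" and "e p x = d p x" using x restD by (auto simp: changed_def)
    note eqs = restD(4,5)[OF x(1)] offset[OF x(1)]
    have "d p x + 4 \<le> 3 + d u x"
      using A.four_point[OF p(1) xV uv(1,2)] uv p eqs A.sym[OF xV] A.sym[OF p(1)] by auto
    moreover have "e q x + 2 \<le> 1 + d u x"
      using B.four_point[OF q(1) xV uv(1,2)] uv q eqs B.sym[OF xV] B.sym[OF q(1)] by auto
    moreover have "e q p \<ge> 2"
    proof -
      have "e q p \<noteq> 0" using B.zero_iff p q by metis
      moreover have "even (e q p)" using B.parity[OF q(1) uv(1) p(1)] p q B.sym[OF q(1) uv(1)] by auto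
      ultimately show ?thesis by presburger
    qed
    then have "d u x + 2 \<le> 1 + e p x \<or> d u x + 2 \<le> 1 + e q x"
      using B.four_point[OF uv(1) xV q(1) p(1)] p q eqs B.sym[OF xV] B.sym[OF p(1)] by auto
    ultimately show False using \<open>e p x = d p x\<close> by linarith
  qed
  obtain u' v' q where *: "changed u \<subseteq> {v, u'}" "changed v \<subseteq> {u, v'}" "V - {u, v, u', v'} \<subseteq> rest u v"
    and q: "q \<in> V" "e u q = 1" "e v q = 1" "q = u' \<or> q = v'"
    using four_two_middle[OF assms(1-4)] by metis
  obtain p1 where p1: "p1 \<in> V" "d u p1 = 1" "d p1 v = 3"
    using A.between[OF assms(1,2), of 1] assms(3) by auto
  obtain p3 where p3: "p3 \<in> V" "d u p3 = 3" "d p3 v = 1"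
    using A.between[OF assms(1,2), of 3] assms(3) by auto
  have p: "d v p1 = 3" "d v p3 = 1" using p1 p3 A.sym assms by metis+
  have ne: "p1 \<noteq> u" "p1 \<noteq> v" "p3 \<noteq> u" "p3 \<noteq> v" "p1 \<noteq> p3"
    using p1 p3 p A.zero_iff[OF assms(1,1)] A.zero_iff[OF assms(2,2)] by auto
  moreover have "p1 \<notin> rest u v" "p3 \<notin> rest u v" using offset p1 p3 p by force+
  ultimately have split: "p1 = u' \<and> p3 = v' \<or> p1 = v' \<and> p3 = u'" using *(3) p1 p3 by blast
  have unchanged: "e w x = d w x" if "x \<in> V" "x \<notin> changed w" for w x using that by (simp add: changed_def)
  show False
  proof (cases "p1 = u'")
    case True
    then have "p1 \<notin> changed v" "p3 \<notin> changed u" using split ne * by auto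
    then have "e v p1 = 3" "e u p3 = 3" using unchanged p1 p3 p by auto
    then show False using q True split ne by auto
  next
    case False
    then have "p1 \<notin> changed u" "p3 \<notin> changed v" using split ne * by auto
    then have e: "e u p1 = 1" "e v p3 = 1" using unchanged p1 p3 p by auto
    show False
    proof (cases "q = p3")
      case True
      then show False using crossed[of u v p1 q] assms p1 p ne q e by auto
    next
      case False
      then have "d v u = 4" "e v u = 2" "p3 \<noteq> q"
        using assms(1-4) A.sym[OF assms(1,2)] B.sym[OF assms(1,2)] by auto
      then show False
        using crossed[of v u p3 q] assms(1,2) offset rest_commute[of u v] p3 p q e by auto
    qed
  qed
qed

text \<open>The offset \<open>c\<close> has the parity of \<open>d u v\<close>, and the triangle
  inequality in \<open>e\<close> bounds its absolute value by \<open>e u v\<close>. Since 0 is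
  excluded, by parity for 3 and 1 and by \<open>four_two_offset_zero\<close> for 4 and 2, that
  absolute value equals \<open>e u v = d u v - 2\<close>.\<close>

lemma changed_offset:
  assumes "u \<in> V" "v \<in> V" "e u v < d u v"
  shows "(\<forall>x\<in>rest u v. d u x + 2 = d v x + d u v) \<or> (\<forall>x\<in>rest u v. d v x + 2 = d u x + d u v)"
proof -
  have vN: "v \<in> changed u" using assms by (auto simp: changed_def)
  obtain c where c: "\<And>x. x \<in> rest u v \<Longrightarrow> int (d u x) = int (d v x) + c"
    using rest_offset[OF assms(1) vN] by blast
  obtain x where x: "x \<in> rest u v" using rest_avoid[OF assms(1) vN, of "{}"] by auto
  have xV: "x \<in> V" using restD x by auto
  note facts = c[OF x] restD(4,5)[OF x] A.parity[OF assms(1,2) xV] B.sym[OF assms(1,2)]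
    B.triangle[OF assms(1,2) xV] B.triangle[OF assms(2,1) xV]
  have "even (c + int (d u v))"
    using facts(1,4) by presburger
  moreover have "\<bar>c\<bar> \<le> int (e u v)" using facts by linarith
  moreover have "c \<noteq> 0" if "d u v = 4" "e u v = 2"
    using four_two_offset_zero[OF assms(1,2) that] c by fastforce
  ultimately have "\<bar>c\<bar> = int (d u v) - 2"
    using changed_cases[OF assms] by presburger
  then have "c = int (d u v) - 2 \<or> c = 2 - int (d u v)" by linarith
  then show ?thesis
  proof
    assume "c = int (d u v) - 2"
    then show ?thesis using c by (intro disjI1 ballI) force
  next
    assume "c = 2 - int (d u v)"
    then show ?thesis using c by (intro disjI2 ballI) force
  qed
qed

lemma exists_three_one:
  assumes "u \<in> V" "v \<in> V" "e u v < d u v"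
  shows "\<exists>a\<in>V. \<exists>b\<in>V. d a b = 3 \<and> e a b = 1"
  using changed_cases[OF assms]
proof
  assume "d u v = 3 \<and> e u v = 1"
  then show ?thesis using assms by blast
next
  assume *: "d u v = 4 \<and> e u v = 2"
  then have **: "d v u = 4" "e v u = 2" using assms A.sym B.sym by metis+
  show ?thesis
    using changed_offset[OF assms]
  proof
    assume "\<forall>x\<in>rest u v. d u x + 2 = d v x + d u v"
    then show ?thesis using four_two_offset_two[of u v] * assms by auto
  next
    assume "\<forall>x\<in>rest u v. d v x + 2 = d u x + d u v"
    then show ?thesis using four_two_offset_two[of v u] * ** assms rest_commute[of u v] by auto
  qed
qed

section \<open>Vertices far from an end of a shrinking pair\<close>

lemma offset_far:
  assumes "u \<in> V" "v \<in> changed u" "finite S" "card S \<le> 4" "2 \<le> d u v"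
    and offset: "\<forall>x\<in>rest u v. d u x + 2 = d v x + d u v"
  shows "\<exists>x\<in>rest u v - S. d u v \<le> d u x"
proof -
  have v: "v \<in> V" using assms(2) by (simp add: changed_def)
  obtain x where x: "x \<in> rest u v" "x \<notin> S"
    using rest_avoid[OF assms(1-3)] assms(4) by auto
  have "card (insert x S) \<le> 8" using card_insert_le_m1[of 8 S x] assms(4) by simp
  then obtain y where y: "y \<in> rest u v" "y \<notin> insert x S"
    using rest_avoid[OF assms(1,2), of "insert x S"] assms(3) by auto
  have V: "x \<in> V" "y \<in> V" by (rule restD(1)[OF x(1)], rule restD(1)[OF y(1)])
  have x': "d u x + 2 = d v x + d u v" using offset x(1) by simp
  have y': "d u y + 2 = d v y + d u v" using offset y(1) by simp
  have "d v x \<noteq> 0" using A.zero_iff[OF v V(1)] restD(3)[OF x(1)] by simp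
  have "d v y \<noteq> 0" using A.zero_iff[OF v V(2)] restD(3)[OF y(1)] by simp
  have "d x y \<noteq> 0" using A.zero_iff[OF V] y(2) by auto
  \<comment> \<open>Only one neighbour of \<open>v\<close> leads towards \<open>u\<close>, so one of
    the two witnesses is at distance at least 2 from \<open>v\<close>; the offset then places it at
    least \<open>d u v\<close> away from \<open>u\<close>.\<close>
  have "\<not> (d v x = 1 \<and> d v y = 1)"
  proof
    assume "d v x = 1 \<and> d v y = 1"
    then show False
      using A.four_point[OF assms(1) v V] x' y' assms(5) \<open>d x y \<noteq> 0\<close> by auto
  qed
  then have "2 \<le> d v x \<or> 2 \<le> d v y" using \<open>d v x \<noteq> 0\<close> \<open>d v y \<noteq> 0\<close> by linarith
  then have "d u v \<le> d u x \<or> d u v \<le> d u y" using x' y' by linarith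
  then show ?thesis using x y by blast
qed

text \<open>\<open>S\<close> is meant to hold the vertices not queried against \<open>u\<close> or
  \<open>v\<close>. The sign of the offset decides which end has the distant partner.\<close>

lemma far_unchanged_pair:
  assumes "u \<in> V" "v \<in> V" "e u v < d u v" "finite S" "card S \<le> 4"
  shows "\<exists>x\<in>V - {u, v} - S. d u v \<le> d u x \<or> d u v \<le> d v x"
proof -
  have two: "2 \<le> d u v" using changed_cases[OF assms(1-3)] by linarith
  have sym: "d v u = d u v" using A.sym assms(1,2) by simp
  have v: "v \<in> changed u" using assms by (simp add: changed_def)
  then have u: "u \<in> changed v" using assms changed_sym by simp
  have "\<exists>x\<in>rest u v - S. d u v \<le> d u x \<or> d u v \<le> d v x"
    using changed_offset[OF assms(1-3)]
  proof
    assume "\<forall>x\<in>rest u v. d u x + 2 = d v x + d u v"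
    then show ?thesis using offset_far[OF assms(1) v assms(4,5) two] by blast
  next
    assume "\<forall>x\<in>rest u v. d v x + 2 = d u x + d u v"
    then have "\<exists>x\<in>rest v u - S. d v u \<le> d v x"
      using two by (intro offset_far[OF assms(2) u assms(4,5)]) (simp_all add: sym rest_commute[of v u])
    then show ?thesis using sym rest_commute[of v u] by auto
  qed
  then show ?thesis by (auto simp: rest_def)
qed

section \<open>Pairs at distance 3 and 1, and the transposition repairing them\<close>

lemma three_one_sibling:
  assumes "u \<in> V" "v \<in> V" "d u v = 3" "e u v = 1"
    and offset: "\<And>x. x \<in> rest u v \<Longrightarrow> d v x = d u x + 1"
  obtains b where "b \<in> V" "b \<noteq> u" "changed v = {u, b}" "d b v = 1" "\<And>x. x \<in> rest u v \<Longrightarrow> d b x = d u x"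
proof -
  have changed: "v \<in> changed u" "u \<in> changed v" using assms changed_sym by (auto simp: changed_def)
  \<comment> \<open>\<open>b\<close> is the vertex from which \<open>v\<close> hangs on its
    \<open>d\<close>-path to \<open>u\<close>; to the witnesses it looks like
    \<open>u\<close>.\<close>
  obtain b where b: "b \<in> V" "d u b = 2" "d b v = 1"
    using A.between[OF assms(1,2), of 2] assms(3) by auto
  have "b \<noteq> u" using b A.zero_iff by force
  have b_eq: "d b x = d u x" if x: "x \<in> rest u v" for x
  proof -
    have xV: "x \<in> V" using restD x by auto
    have "d b x + 3 \<le> 3 + d u x"
      using A.four_point[OF b(1) xV assms(1,2)] b assms(3) offset[OF x] A.sym[OF xV] A.sym[OF b(1)]
        assms(1,2) by auto
    moreover have "d v x \<le> 1 + d b x"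
      using A.triangle[OF assms(2) b(1) xV] b A.sym[OF assms(2) b(1)] by auto
    ultimately show ?thesis using offset[OF x] by linarith
  qed
  \<comment> \<open>Otherwise \<open>u\<close> and \<open>b\<close> would both be neighbours of
    \<open>v\<close> in \<open>e\<close> on the way to a common \<open>x\<close>, hence
    equal.\<close>
  have "b \<in> changed v"
  proof (rule ccontr)
    assume "b \<notin> changed v"
    then have "e v b = 1" using b A.sym[OF assms(2) b(1)] by (simp add: changed_def)
    obtain x where x: "x \<in> rest u v" "x \<notin> changed b"
      using rest_avoid[OF assms(1) changed(1), of "changed b"] card_changed[OF b(1)] by auto
    have xV: "x \<in> V" and "e b x = d b x" using x restD by (auto simp: changed_def)
    then have "e v x + e b u \<le> 1 + d u x"
      using B.four_point[OF assms(2) xV b(1) assms(1)] \<open>e v b = 1\<close> restD(4,5)[OF x(1)] b_eq[OF x(1)]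
        B.sym[OF xV] B.sym[OF assms(2,1)] assms b by auto
    then have "e b u = 0" using restD(5)[OF x(1)] offset[OF x(1)] by linarith
    then show False using B.zero_iff b(1) assms(1) \<open>b \<noteq> u\<close> by blast
  qed
  then have "changed v = {u, b}"
    using changed(2) \<open>b \<noteq> u\<close> card_changed[OF assms(2)] card_seteq[of "changed v" "{u, b}"] by auto
  then show ?thesis using that b \<open>b \<noteq> u\<close> b_eq by blast
qed

text \<open>The roles of \<open>u\<close> and \<open>b\<close> are symmetric:
  \<open>three_one_sibling\<close> for \<open>(b, v)\<close> with the metrics exchanged yields a
  vertex that forms \<open>changed v\<close> together with \<open>b\<close>, and this can only be
  \<open>u\<close>.\<close>

lemma three_one_transposable:
  assumes "u \<in> V" "v \<in> V" "d u v = 3" "e u v = 1"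
    and offset: "\<And>x. x \<in> rest u v \<Longrightarrow> d v x = d u x + 1"
  obtains b where "b \<in> V" "b \<noteq> u" "changed v = {u, b}" "d b v = 1" "e b v = 3"
    "\<And>x. x \<in> rest u v \<Longrightarrow> d b x = d u x" "\<And>x. x \<in> rest b v \<Longrightarrow> e u x = e b x"
proof -
  interpret R: tree_metric_pair V e d by (rule swapped)
  have R: "R.changed = changed" "R.rest = rest" by (auto simp: fun_eq_iff R.changed_def changed_def R.rest_def rest_def)
  obtain b where b: "b \<in> V" "b \<noteq> u" "changed v = {u, b}" "d b v = 1"
    "\<And>x. x \<in> rest u v \<Longrightarrow> d b x = d u x"
    using three_one_sibling[OF assms] by metis
  have "b \<in> changed v" using b by auto
  then have bN: "v \<in> changed b" and vN: "v \<in> changed u" using changed_sym assms b by (auto simp: changed_def)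
  \<comment> \<open>Being neither 0 nor \<open>d b v = 1\<close>, the value \<open>e b v\<close> is
    larger, and a changed pair with smaller value 1 has larger value 3.\<close>
  have "e b v \<noteq> 0" using B.zero_iff b(1,4) assms(2) A.zero_iff by (metis zero_neq_one)
  then have "d b v < e b v" using bN b(4) by (simp add: changed_def)
  then have eb: "e b v = 3" using R.changed_cases[OF b(1) assms(2)] b(4) by auto
  \<comment> \<open>One witness common to \<open>rest u v\<close> and \<open>rest b v\<close>
    carries the offset over to \<open>e\<close>; \<open>rest_exchange\<close> spreads it over
    \<open>rest b v\<close>.\<close>
  obtain x where x: "x \<in> rest u v" "x \<notin> changed b \<union> {b}"
    using rest_avoid[OF assms(1) vN, of "changed b \<union> {b}"] card_changed[OF b(1)]
      card_insert_le_m1[of 8 "changed b" b] by auto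
  then have xW: "x \<in> rest b v" by (auto simp: rest_def)
  then have "e v x = e b x + 1"
    using restD(4,5)[OF xW] b(5)[OF x(1)] offset[OF x(1)] by simp
  then have offset': "e v y = e b y + 1" if "y \<in> rest b v" for y
    using R.rest_exchange[of b v x y] R b(1) bN xW that by simp
  obtain b' where b': "b' \<noteq> b" "changed v = {b, b'}" "\<And>x. x \<in> rest b v \<Longrightarrow> e b' x = e b x"
    using R.three_one_sibling[OF b(1) assms(2) eb b(4)] offset' R by metis
  then have "b' = u" using b(2,3) by (metis doubleton_eq_iff)
  then show ?thesis using that b b' eb by blast
qed

text \<open>The distances from \<open>v\<close> to \<open>u\<close> and \<open>b\<close> are 3 and 1
  in \<open>d\<close> but 1 and 3 in \<open>e\<close>, so exchanging the two labels removes every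
  disagreement at \<open>v\<close>. Any other disagreement after the exchange is traced to an old
  one at \<open>u\<close> or \<open>b\<close>, or was there before.\<close>

lemma transposition_improves:
  assumes "u \<in> V" "v \<in> V" "d u v = 3" "e u v = 1"
    and offset: "\<forall>x\<in>rest u v. d v x = d u x + 1"
  obtains b where "b \<in> V"
    "\<forall>x\<in>V. card {y \<in> V. d x y \<noteq> e (exchange u b x) (exchange u b y)} \<le> 2"
    "{x \<in> V. \<exists>y\<in>V. d x y \<noteq> e (exchange u b x) (exchange u b y)}
      \<subset> {x \<in> V. \<exists>y\<in>V. d x y \<noteq> e x y}"
proof -
  obtain b where b: "b \<in> V" "b \<noteq> u" "changed v = {u, b}" "d b v = 1" "e b v = 3"
    "\<And>x. x \<in> rest u v \<Longrightarrow> d b x = d u x" "\<And>x. x \<in> rest b v \<Longrightarrow> e u x = e b x"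
    using three_one_transposable[OF assms(1-4)] offset by metis
  define M where "M x = {y \<in> V. d x y \<noteq> e (exchange u b x) (exchange u b y)}" for x
  have vub: "v \<noteq> u" "v \<noteq> b"
    using b(4) assms A.zero_iff[of v v] by auto
  have NV: "v \<in> changed u" "v \<in> changed b" using changed_sym b assms by auto
  have rest: "y \<in> rest u v \<longleftrightarrow> y \<notin> changed u" "y \<in> rest b v \<longleftrightarrow> y \<notin> changed b"
    if "y \<in> V" "y \<noteq> u" "y \<noteq> b" "y \<noteq> v" for y
    using that b(3) by (auto simp: rest_def)
  have same: "e x y = d x y" "e y x = d y x" if "y \<in> V" "x \<in> V" "y \<notin> changed x" for x y
    using that A.sym B.sym by (auto simp: changed_def)
  \<comment> \<open>If \<open>y\<close> were unchanged at both \<open>u\<close> and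
    \<open>b\<close>, then \<open>e b y = d b y = d u y\<close>.\<close>
  have u_in: "y \<in> changed u \<union> changed b" if "e b y \<noteq> d u y" "y \<in> V" "y \<noteq> u" "y \<noteq> b" "y \<noteq> v" for y
    using that rest b(6) same assms(1) b(1) by (metis UnI1 UnI2)
  \<comment> \<open>If \<open>y\<close> is unchanged at even one of \<open>u\<close> and
    \<open>b\<close>, one of the two sibling equations already gives
    \<open>e u y = d b y\<close>.\<close>
  have b_in: "y \<in> changed u" "y \<in> changed b" if "e u y \<noteq> d b y" "y \<in> V" "y \<noteq> u" "y \<noteq> b" "y \<noteq> v" for y
    using that rest b(6,7) same assms(1) b(1) by metis+
  have Mv: "M v = {}"
  proof -
    have "e v y = d v y" if "y \<in> V" "y \<noteq> u" "y \<noteq> b" for y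
      using same that b(3) assms(2) by auto
    moreover have "d v u = e v b" "d v b = e v u"
      using assms b A.sym B.sym by metis+
    ultimately show ?thesis using vub by (auto simp: M_def)
  qed
  \<comment> \<open>Without \<open>v\<close> each part has at most one element, so the new degree of
    \<open>u\<close> is at most 2.\<close>
  have Mu: "M u \<subseteq> (changed u - {v}) \<union> (changed b - {u, v})"
  proof
    fix y assume y: "y \<in> M u"
    then have "y \<in> V" by (simp add: M_def)
    have "y \<noteq> u"
      using y A.zero_iff[OF assms(1,1)] B.zero_iff[OF b(1,1)] b(2) by (auto simp: M_def)
    have "y \<noteq> v" using y vub b assms by (auto simp: M_def)
    show "y \<in> (changed u - {v}) \<union> (changed b - {u, v})"
    proof (cases "y = b")
      case True
      then have "d u b \<noteq> e u b" using y b B.sym[OF assms(1) b(1)] by (auto simp: M_def)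
      then show ?thesis using True b(1) \<open>y \<noteq> v\<close> by (auto simp: changed_def)
    next
      case False
      then have "e b y \<noteq> d u y" using y \<open>y \<noteq> u\<close> b(2) by (auto simp: M_def)
      then show ?thesis using u_in[of y] \<open>y \<in> V\<close> \<open>y \<noteq> u\<close> \<open>y \<noteq> v\<close> False by auto
    qed
  qed
  have Mb: "M b \<subseteq> changed b"
  proof
    fix y assume y: "y \<in> M b"
    then have "y \<in> V" by (simp add: M_def)
    have "y \<noteq> b"
      using y A.zero_iff[OF b(1,1)] B.zero_iff[OF assms(1,1)] b(2) by (auto simp: M_def)
    have "y \<noteq> v" using y vub b assms by (auto simp: M_def)
    show "y \<in> changed b"
    proof (cases "y = u")
      case True
      then have "d b u \<noteq> e b u" using y b B.sym[OF assms(1) b(1)] by (auto simp: M_def)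
      then show ?thesis using True assms(1) by (auto simp: changed_def)
    next
      case False
      then have "e u y \<noteq> d b y" using y \<open>y \<noteq> b\<close> b(2) by (auto simp: M_def)
      then show ?thesis using b_in[of y] \<open>y \<in> V\<close> \<open>y \<noteq> b\<close> \<open>y \<noteq> v\<close> False by auto
    qed
  qed
  \<comment> \<open>Unless it was there before, \<open>u\<close> enters the disagreements of
    \<open>y\<close> only in place of \<open>b\<close>, so their number does not exceed 2.\<close>
  have My: "M y \<subseteq> changed y \<or> M y \<subseteq> insert u (changed y - {b}) \<and> b \<in> changed y"
    if y: "y \<in> V" "y \<noteq> u" "y \<noteq> b" "y \<noteq> v" for y
  proof -
    have other: "z \<in> changed y" if "z \<in> M y" "z \<noteq> u" "z \<noteq> b" for z
      using that y by (auto simp: M_def changed_def)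
    have u: "u \<in> changed y \<or> b \<in> changed y" if "u \<in> M y"
    proof -
      have "d y u \<noteq> e y b" using that y b(2) by (auto simp: M_def)
      then have "e b y \<noteq> d u y" using A.sym B.sym y b(1) assms(1) by metis
      then show ?thesis using u_in[of y] y changed_sym b(1) assms(1) by blast
    qed
    have bb: "u \<in> changed y \<and> b \<in> changed y" if "b \<in> M y"
    proof -
      have "d y b \<noteq> e y u" using that y b(2) by (auto simp: M_def)
      then have "e u y \<noteq> d b y" using A.sym B.sym y b(1) assms(1) by metis
      then show ?thesis using b_in[of y] y changed_sym b(1) assms(1) by blast
    qed
    show ?thesis using other u bb by blast
  qed
  have deg: "card (M x) \<le> 2" if "x \<in> V" for x
  proof -
    consider "x = u" | "x = b" | "x = v" | "x \<noteq> u" "x \<noteq> b" "x \<noteq> v" by blast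
    then show ?thesis
    proof cases
      case 1
      have "card (M u) \<le> card (changed u - {v}) + card (changed b - {u, v})"
        using card_mono[OF _ Mu] card_Un_le[of "changed u - {v}" "changed b - {u, v}"] by auto
      moreover have "card (changed u - {v}) \<le> 1" using NV card_changed[OF assms(1)] by simp
      moreover have "card (changed b - {u, v}) \<le> card (changed b - {v})" by (rule card_mono) auto
      moreover have "card (changed b - {v}) \<le> 1" using NV card_changed[OF b(1)] by simp
      ultimately show ?thesis using 1 by simp
    next
      case 2
      then show ?thesis using card_mono[OF _ Mb] card_changed[OF b(1)] by auto
    next
      case 3
      then show ?thesis using Mv by simp
    next
      case 4
      show ?thesis
        using My[OF that 4]
      proof
        assume "M x \<subseteq> changed x"
        then show ?thesis using card_mono[of "changed x" "M x"] card_changed[OF that] by simp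
      next
        assume *: "M x \<subseteq> insert u (changed x - {b}) \<and> b \<in> changed x"
        then have "card (M x) \<le> card (insert u (changed x - {b}))" by (intro card_mono) auto
        also have "\<dots> \<le> Suc (card (changed x - {b}))" by (rule card_insert_le_m1) auto
        also have "\<dots> \<le> 2" using * card_changed[OF that] by simp
        finally show ?thesis .
      qed
    qed
  qed
  have "changed x \<noteq> {}" if "x \<in> V" "M x \<noteq> {}" for x
  proof -
    consider "x = u" | "x = b" | "x = v" | "x \<noteq> u" "x \<noteq> b" "x \<noteq> v" by blast
    then show ?thesis
      by cases (use NV Mv that My[of x] in auto)
  qed
  then have "{x \<in> V. M x \<noteq> {}} \<subseteq> {x \<in> V. changed x \<noteq> {}}" by auto
  \<comment> \<open>\<open>v\<close> becomes isolated, which makes the inclusion strict.\<close>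
  moreover have "v \<in> {x \<in> V. changed x \<noteq> {}}" "v \<notin> {x \<in> V. M x \<noteq> {}}" using b(3) assms(2) Mv by auto
  ultimately have "{x \<in> V. M x \<noteq> {}} \<subset> {x \<in> V. changed x \<noteq> {}}" by blast
  moreover have "{x \<in> V. M x \<noteq> {}} =
      {x \<in> V. \<exists>y\<in>V. d x y \<noteq> e (exchange u b x) (exchange u b y)}"
    and "{x \<in> V. changed x \<noteq> {}} = {x \<in> V. \<exists>y\<in>V. d x y \<noteq> e x y}"
    by (auto simp: M_def changed_def simp del: fun_upd_apply)
  ultimately show ?thesis
    using deg by (intro that[OF b(1)]) (auto simp: M_def simp del: fun_upd_apply)
qed

lemma exists_improving_transposition:
  assumes "u \<in> V" "v \<in> V" "e u v < d u v"
  obtains a b where "a \<in> V" "b \<in> V"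
    "\<forall>x\<in>V. card {y \<in> V. d x y \<noteq> e (exchange a b x) (exchange a b y)} \<le> 2"
    "{x \<in> V. \<exists>y\<in>V. d x y \<noteq> e (exchange a b x) (exchange a b y)}
      \<subset> {x \<in> V. \<exists>y\<in>V. d x y \<noteq> e x y}"
proof -
  obtain s t where st: "s \<in> V" "t \<in> V" "d s t = 3" "e s t = 1"
    using exists_three_one[OF assms] by blast
  then have ts: "d t s = 3" "e t s = 1" using A.sym B.sym by metis+
  have "(\<forall>x\<in>rest s t. d s x + 2 = d t x + 3) \<or> (\<forall>x\<in>rest s t. d t x + 2 = d s x + 3)"
    using changed_offset[OF st(1,2)] st by simp
  then show ?thesis
  proof
    assume "\<forall>x\<in>rest s t. d s x + 2 = d t x + 3"
    then have off: "\<forall>x\<in>rest t s. d s x = d t x + 1" using rest_commute[of s t] by force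
    show ?thesis by (rule transposition_improves[OF st(2,1) ts off]) (rule that[OF st(2)])
  next
    assume "\<forall>x\<in>rest s t. d t x + 2 = d s x + 3"
    then have off: "\<forall>x\<in>rest s t. d t x = d s x + 1" by force
    show ?thesis by (rule transposition_improves[OF st off]) (rule that[OF st(1)])
  qed
qed

end

section \<open>Iterated transpositions yield an isometry\<close>

theorem tree_metrics_isometric:
  assumes "tree_metric_pair V d e"
  shows "\<exists>\<sigma>. bij_betw \<sigma> V V \<and> (\<forall>x\<in>V. \<forall>y\<in>V. e (\<sigma> x) (\<sigma> y) = d x y)"
  using assms
\<comment> \<open>The measure is the number of non-isolated vertices of the disagreement
  graph.\<close>
proof (induction "card {x \<in> V. \<exists>y\<in>V. d x y \<noteq> e x y}" arbitrary: d e rule: less_induct)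
  case less
  interpret tree_metric_pair V d e by (rule less.prems)
  interpret R: tree_metric_pair V e d by (rule swapped)
  have swap_bij: "bij_betw (exchange a b) V V" if "a \<in> V" "b \<in> V" for a b
    using that by (intro bij_betw_byWitness[where f' = "exchange a b"]) auto
  have sup: "{x \<in> V. \<exists>y\<in>V. e x y \<noteq> d x y} = {x \<in> V. \<exists>y\<in>V. d x y \<noteq> e x y}" by metis
  show ?case
  proof (cases "\<forall>x\<in>V. \<forall>y\<in>V. d x y = e x y")
    case True
    then show ?thesis by (intro exI[of _ id]) auto
  next
    case False
    then obtain u v where uv: "u \<in> V" "v \<in> V" "d u v \<noteq> e u v" by blast
    show ?thesis
    proof (cases "e u v < d u v")
      case True
      obtain a b where ab: "a \<in> V" "b \<in> V"
        "\<forall>x\<in>V. card {y \<in> V. d x y \<noteq> e (exchange a b x) (exchange a b y)} \<le> 2"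
        "{x \<in> V. \<exists>y\<in>V. d x y \<noteq> e (exchange a b x) (exchange a b y)}
          \<subset> {x \<in> V. \<exists>y\<in>V. d x y \<noteq> e x y}"
        by (rule exists_improving_transposition[OF uv(1,2) True])
      define \<tau> where "\<tau> = exchange a b"
      note ab = ab[folded \<tau>_def]
      have \<tau>: "bij_betw \<tau> V V" unfolding \<tau>_def by (rule swap_bij) fact+
      have "tree_metric_pair V d (\<lambda>x y. e (\<tau> x) (\<tau> y))"
        using B.permute[OF \<tau>] A.tree_metric_axioms ab(3)
          finite_V large by (intro tree_metric_pair.intro tree_metric_pair_axioms.intro) auto
      then obtain \<sigma> where "bij_betw \<sigma> V V" "\<forall>x\<in>V. \<forall>y\<in>V. e (\<tau> (\<sigma> x)) (\<tau> (\<sigma> y)) = d x y"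
        using less.hyps[of d "\<lambda>x y. e (\<tau> x) (\<tau> y)"] psubset_card_mono[OF _ ab(4)] finite_V by auto
      then show ?thesis using bij_betw_trans[of \<sigma> V V \<tau> V] \<tau> by (intro exI[of _ "\<tau> \<circ> \<sigma>"]) auto
    next
      case False
      then have "d u v < e u v" using uv by simp
      then obtain a b where ab: "a \<in> V" "b \<in> V"
        "\<forall>x\<in>V. card {y \<in> V. e x y \<noteq> d (exchange a b x) (exchange a b y)} \<le> 2"
        "{x \<in> V. \<exists>y\<in>V. e x y \<noteq> d (exchange a b x) (exchange a b y)}
          \<subset> {x \<in> V. \<exists>y\<in>V. e x y \<noteq> d x y}"
        by (rule R.exists_improving_transposition[OF uv(1,2)])
      define \<tau> where "\<tau> = exchange a b"
      note ab = ab[folded \<tau>_def]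
      have \<tau>: "bij_betw \<tau> V V" unfolding \<tau>_def by (rule swap_bij) fact+
      have "tree_metric_pair V e (\<lambda>x y. d (\<tau> x) (\<tau> y))"
        using A.permute[OF \<tau>] B.tree_metric_axioms ab(3)
          finite_V large by (intro tree_metric_pair.intro tree_metric_pair_axioms.intro) auto
      then obtain \<sigma> where \<sigma>: "bij_betw \<sigma> V V" "\<forall>x\<in>V. \<forall>y\<in>V. d (\<tau> (\<sigma> x)) (\<tau> (\<sigma> y)) = e x y"
        using less.hyps[of e "\<lambda>x y. d (\<tau> x) (\<tau> y)"] psubset_card_mono[OF _ ab(4)] finite_V sup
        by auto
      \<comment> \<open>Here \<open>d\<close> was relabelled instead of \<open>e\<close>, so the
        composite runs the wrong way and is inverted.\<close>
      define \<rho> where "\<rho> = inv_into V (\<tau> \<circ> \<sigma>)"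
      have bij: "bij_betw (\<tau> \<circ> \<sigma>) V V" using bij_betw_trans[OF \<sigma>(1) \<tau>] .
      then have "bij_betw \<rho> V V" unfolding \<rho>_def by (rule bij_betw_inv_into)
      moreover have "\<tau> (\<sigma> (\<rho> x)) = x" if "x \<in> V" for x
        using bij_betw_inv_into_right[OF bij that] by (simp add: \<rho>_def)
      ultimately show ?thesis using \<sigma>(2) by (intro exI[of _ \<rho>]) (metis bij_betwE)
    qed
  qed
qed

subsection \<open>Distances in trees\<close>

definition walk_of_length :: "'a set \<Rightarrow> 'a set set \<Rightarrow> nat \<Rightarrow> 'a \<Rightarrow> 'a \<Rightarrow> bool" where
  "walk_of_length V E k u v \<longleftrightarrow> (\<exists>p. walk_betw V E u p v \<and> length p = Suc k)"

lemma walk_of_length_0: "walk_of_length V E 0 u v \<longleftrightarrow> u = v \<and> u \<in> V"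
  by (auto simp: walk_of_length_def walk_betw_def length_Suc_conv intro!: exI[of _ "[v]"])

lemma walk_of_length_Suc:
  "walk_of_length V E (Suc k) u v \<longleftrightarrow> u \<in> V \<and> (\<exists>w. {u, w} \<in> E \<and> walk_of_length V E k w v)"
proof
  assume "walk_of_length V E (Suc k) u v"
  then obtain p where p: "walk_betw V E u p v" "length p = Suc (Suc k)"
    by (auto simp: walk_of_length_def)
  then obtain q where q: "p = u # q" "q \<noteq> []" "length q = Suc k"
    by (auto simp: walk_betw_def length_Suc_conv)
  then have "walk_betw V E (hd q) q v" "{u, hd q} \<in> E" "u \<in> V"
    using p by (auto simp: walk_betw_def successively_Cons)
  then show "u \<in> V \<and> (\<exists>w. {u, w} \<in> E \<and> walk_of_length V E k w v)"
    using q by (auto simp: walk_of_length_def)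
next
  assume "u \<in> V \<and> (\<exists>w. {u, w} \<in> E \<and> walk_of_length V E k w v)"
  then obtain w q where "u \<in> V" "{u, w} \<in> E" "walk_betw V E w q v" "length q = Suc k"
    by (auto simp: walk_of_length_def)
  then have "walk_betw V E u (u # q) v \<and> length (u # q) = Suc (Suc k)"
    by (auto simp: walk_betw_def successively_Cons)
  then show "walk_of_length V E (Suc k) u v"
    unfolding walk_of_length_def by blast
qed

lemma graph_dist_Least: "graph_dist V E u v = (LEAST k. walk_of_length V E k u v)"
  by (simp add: graph_dist_def walk_of_length_def)

lemma graph_connected_iff:
  "graph_connected V E \<longleftrightarrow> (\<forall>u\<in>V. \<forall>v\<in>V. \<exists>k. walk_of_length V E k u v)"
proof -
  have "(\<exists>p. walk_betw V E u p v) \<longleftrightarrow> (\<exists>k. walk_of_length V E k u v)" for u v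
    unfolding walk_of_length_def by (metis Suc_pred length_greater_0_conv walk_betw_def)
  then show ?thesis by (simp add: graph_connected_def)
qed

lemma edge_in: "E \<subseteq> [V]\<^bsup>2\<^esup> \<Longrightarrow> {u, w} \<in> E \<Longrightarrow> u \<in> V \<and> w \<in> V \<and> u \<noteq> w"
  by (auto simp: nsets_def card_2_iff doubleton_eq_iff)

text \<open>\<open>D\<close> need not be the distance of this graph: adding or removing a leaf keeps
  a graph connected because an explicit formula, or the old distance, still descends along the
  edges.\<close>

lemma walk_of_descent:
  fixes D :: "'a \<Rightarrow> 'a \<Rightarrow> nat"
  assumes descent: "\<And>u v. u \<in> V \<Longrightarrow> v \<in> V \<Longrightarrow> u \<noteq> v \<Longrightarrow>
      \<exists>w\<in>V. {u, w} \<in> E \<and> Suc (D w v) = D u v"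
    and refl: "\<And>v. v \<in> V \<Longrightarrow> D v v = 0"
    and "u \<in> V" "v \<in> V"
  shows "walk_of_length V E (D u v) u v"
  using assms(3)
proof (induction "D u v" arbitrary: u rule: less_induct)
  case less
  show ?case
  proof (cases "u = v")
    case True
    then show ?thesis using refl less.prems by (simp add: walk_of_length_0)
  next
    case False
    then obtain w where w: "w \<in> V" "{u, w} \<in> E" "Suc (D w v) = D u v"
      using descent less.prems assms(4) by blast
    then have "walk_of_length V E (Suc (D w v)) u v"
      unfolding walk_of_length_Suc using less.hyps[of w] less.prems by auto
    then show ?thesis using w by simp
  qed
qed

text \<open>Descent provides a walk of length \<open>D u v\<close>, and the Lipschitz bound along
  edges shows that no walk is shorter.\<close>

lemma graph_dist_eqI:
  fixes D :: "'a \<Rightarrow> 'a \<Rightarrow> nat"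
  assumes E: "E \<subseteq> [V]\<^bsup>2\<^esup>"
    and descent: "\<And>u v. u \<in> V \<Longrightarrow> v \<in> V \<Longrightarrow> u \<noteq> v \<Longrightarrow>
      \<exists>w\<in>V. {u, w} \<in> E \<and> Suc (D w v) = D u v"
    and refl: "\<And>v. v \<in> V \<Longrightarrow> D v v = 0"
    and lipschitz: "\<And>u v w. {u, w} \<in> E \<Longrightarrow> v \<in> V \<Longrightarrow> D u v \<le> Suc (D w v)"
    and "u \<in> V" "v \<in> V"
  shows "graph_dist V E u v = D u v"
  unfolding graph_dist_Least
proof (rule Least_equality)
  show "walk_of_length V E (D u v) u v"
    using walk_of_descent[of V E D] assms by blast
  fix k assume "walk_of_length V E k u v"
  then show "D u v \<le> k"
  proof (induction k arbitrary: u)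
    case 0
    then show ?case using refl by (auto simp: walk_of_length_0)
  next
    case (Suc k)
    then show ?case using lipschitz assms(6) by (fastforce simp: walk_of_length_Suc)
  qed
qed

context
  fixes V :: "'a set" and E :: "'a set set"
  assumes E: "E \<subseteq> [V]\<^bsup>2\<^esup>" and conn: "graph_connected V E"
begin

lemma graph_dist_walk:
  assumes "u \<in> V" "v \<in> V"
  shows "walk_of_length V E (graph_dist V E u v) u v"
  unfolding graph_dist_Least
  using conn assms by (metis LeastI_ex graph_connected_iff)

lemma graph_dist_le: "walk_of_length V E k u v \<Longrightarrow> graph_dist V E u v \<le> k"
  unfolding graph_dist_Least by (rule Least_le)

lemma graph_dist_refl: "v \<in> V \<Longrightarrow> graph_dist V E v v = 0"
  using graph_dist_le[of 0 v v] by (simp add: walk_of_length_0)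

lemma graph_dist_edge_le:
  assumes "{u, w} \<in> E" "v \<in> V"
  shows "graph_dist V E u v \<le> Suc (graph_dist V E w v)"
  using edge_in[OF E assms(1)] assms graph_dist_walk[of w v]
  by (intro graph_dist_le) (auto simp: walk_of_length_Suc)

lemma graph_dist_descent:
  assumes "u \<in> V" "v \<in> V" "u \<noteq> v"
  shows "\<exists>w\<in>V. {u, w} \<in> E \<and> Suc (graph_dist V E w v) = graph_dist V E u v"
proof (cases "graph_dist V E u v")
  case 0
  then show ?thesis using graph_dist_walk[OF assms(1,2)] assms(3) by (simp add: walk_of_length_0)
next
  case (Suc k)
  then obtain w where w: "{u, w} \<in> E" "walk_of_length V E k w v"
    using graph_dist_walk[OF assms(1,2)] by (auto simp: walk_of_length_Suc)
  then have "graph_dist V E w v \<le> k" by (intro graph_dist_le)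
  then show ?thesis
    using graph_dist_edge_le[OF w(1) assms(2)] Suc w(1) edge_in[OF E w(1)] by force
qed

end

text \<open>The explicit \<open>D\<close> leads every path at the new leaf through \<open>m\<close>;
  it passes the test of \<open>graph_dist_eqI\<close>.\<close>

lemma graph_dist_insert_leaf:
  assumes E: "E \<subseteq> [V]\<^bsup>2\<^esup>" and conn: "graph_connected V E" and x: "x \<notin> V" and m: "m \<in> V"
  defines "D \<equiv> \<lambda>y z. if y = x then if z = x then 0 else Suc (graph_dist V E m z)
                else if z = x then Suc (graph_dist V E y m) else graph_dist V E y z"
  shows "insert {x, m} E \<subseteq> [insert x V]\<^bsup>2\<^esup>"
    and "graph_connected (insert x V) (insert {x, m} E)"
    and "y \<in> insert x V \<Longrightarrow> z \<in> insert x V \<Longrightarrow>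
      graph_dist (insert x V) (insert {x, m} E) y z = D y z"
proof -
  note dist = graph_dist_refl[OF E conn] graph_dist_edge_le[OF E conn] graph_dist_descent[OF E conn]
  have "{x, m} \<in> [insert x V]\<^bsup>2\<^esup>" using x m by (auto simp: nsets_def card_2_iff)
  moreover have "[V]\<^bsup>2\<^esup> \<subseteq> [insert x V]\<^bsup>2\<^esup>" by (auto simp: nsets_def)
  ultimately show E': "insert {x, m} E \<subseteq> [insert x V]\<^bsup>2\<^esup>" using E by blast
  have descent: "\<exists>w\<in>insert x V. {u, w} \<in> insert {x, m} E \<and> Suc (D w v) = D u v"
    if uv: "u \<in> insert x V" "v \<in> insert x V" "u \<noteq> v" for u v
  proof -
    consider "u = x" "v \<in> V" | "u = m" "v = x" | "u \<in> V" "u \<noteq> m" "v = x" | "u \<in> V" "v \<in> V"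
      using uv by blast
    then show ?thesis
    proof cases
      case 1
      then show ?thesis using x m by (intro bexI[of _ m]) (auto simp: D_def)
    next
      case 2
      then show ?thesis using x m dist(1)[OF m] by (intro bexI[of _ x]) (auto simp: D_def insert_commute)
    next
      case 3
      then show ?thesis using dist(3)[of u m] m x by (force simp: D_def)
    next
      case 4
      then show ?thesis using dist(3)[of u v] uv x by (force simp: D_def)
    qed
  qed
  have refl: "D v v = 0" if "v \<in> insert x V" for v using that dist(1) by (auto simp: D_def)
  have lipschitz: "D u v \<le> Suc (D w v)" if uw: "{u, w} \<in> insert {x, m} E" "v \<in> insert x V" for u v w
  proof -
    consider "u = x" "w = m" | "u = m" "w = x" | "{u, w} \<in> E" "u \<in> V" "w \<in> V"
      using uw(1) edge_in[OF E, of u w] by (auto simp: doubleton_eq_iff)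
    then show ?thesis
    proof cases
      case 1
      then show ?thesis using x m uw dist(1)[OF m] by (auto simp: D_def)
    next
      case 2
      then show ?thesis using x m uw dist(1)[OF m] by (auto simp: D_def)
    next
      case 3
      then show ?thesis using x m uw(2) dist(2) by (auto simp: D_def)
    qed
  qed
  show "graph_connected (insert x V) (insert {x, m} E)"
    unfolding graph_connected_iff using walk_of_descent[of _ _ D, OF descent refl] by blast
  show "graph_dist (insert x V) (insert {x, m} E) y z = D y z"
    if "y \<in> insert x V" "z \<in> insert x V"
    using graph_dist_eqI[of _ _ D, OF E' descent refl lipschitz that] .
qed

section \<open>Cycles, leaves and induction on trees\<close>

lemma cycle_neighbours:
  assumes "graph_cycle V E p" "x \<in> set p"
  obtains y z where "y \<noteq> z" "{x, y} \<in> E" "{x, z} \<in> E"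
proof -
  have len: "3 \<le> length p" and dist: "distinct p" and close: "{last p, hd p} \<in> E"
    and step: "\<And>i. Suc i < length p \<Longrightarrow> {p ! i, p ! Suc i} \<in> E"
    using assms(1) by (auto simp: graph_cycle_def walk_betw_def successively_conv_nth)
  have ends: "last p = p ! (length p - 1)" "hd p = p ! 0"
    using len by (cases p; auto simp: last_conv_nth)+
  obtain i where i: "i < length p" "x = p ! i" using assms(2) by (metis in_set_conv_nth)
  \<comment> \<open>At the first and at the last index one of the neighbours comes from the closing
    edge.\<close>
  consider "i = 0" | "0 < i" "Suc i < length p" | "0 < i" "i = length p - 1" using i len by linarith
  then show ?thesis
  proof cases
    case 1
    moreover have "p ! 1 \<noteq> p ! (length p - 1)" using dist len by (subst nth_eq_iff_index_eq) auto
    ultimately show ?thesis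
      using that[of "p ! 1" "p ! (length p - 1)"] step[of 0] close ends i len
      by (auto simp: insert_commute)
  next
    case 2
    moreover have "p ! (i - 1) \<noteq> p ! Suc i" using dist 2 by (subst nth_eq_iff_index_eq) auto
    ultimately show ?thesis
      using that[of "p ! (i - 1)" "p ! Suc i"] step[of "i - 1"] step[of i] i
      by (auto simp: insert_commute)
  next
    case 3
    then obtain j where "i = Suc j" by (metis gr0_conv_Suc)
    then have "{p ! (i - 1), p ! i} \<in> E" using step[of j] i(1) by simp
    moreover have "p ! (i - 1) \<noteq> p ! 0" using dist 3 len by (subst nth_eq_iff_index_eq) auto
    ultimately show ?thesis
      using that[of "p ! (i - 1)" "p ! 0"] close ends i 3 by (simp add: insert_commute)
  qed
qed

lemma is_tree_insert_leaf:
  assumes T: "is_tree V E" and x: "x \<notin> V" and m: "m \<in> V"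
  shows "is_tree (insert x V) (insert {x, m} E)"
proof -
  have E: "E \<subseteq> [V]\<^bsup>2\<^esup>" "graph_connected V E" using T by (auto simp: is_tree_def)
  have nocyc: "\<not> graph_cycle (insert x V) (insert {x, m} E) p" for p
  proof
    assume cyc: "graph_cycle (insert x V) (insert {x, m} E) p"
    show False
    proof (cases "x \<in> set p")
      case True
      then obtain y z where yz: "y \<noteq> z" "{x, y} \<in> insert {x, m} E" "{x, z} \<in> insert {x, m} E"
        using cycle_neighbours[OF cyc] by metis
      moreover have "{x, w} \<notin> E" for w using edge_in[OF E(1), of x w] x by blast
      ultimately show False by (auto simp: doubleton_eq_iff)
    next
      case False
      have "p \<noteq> []" using cyc by (auto simp: graph_cycle_def)
      then have "hd p \<noteq> x" "last p \<noteq> x" using False hd_in_set last_in_set by metis+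
      moreover have "successively (\<lambda>a b. {a, b} \<in> E) p"
      proof (rule successively_mono)
        show "successively (\<lambda>a b. {a, b} \<in> insert {x, m} E) p"
          using cyc by (simp add: graph_cycle_def walk_betw_def)
      qed (use False in \<open>auto simp: doubleton_eq_iff\<close>)
      ultimately have "graph_cycle V E p"
        using cyc False by (auto simp: graph_cycle_def walk_betw_def doubleton_eq_iff)
      then show False using T by (auto simp: is_tree_def)
    qed
  qed
  show ?thesis
    using graph_dist_insert_leaf(1,2)[OF E x m] nocyc by (auto simp: is_tree_def)
qed

text \<open>The first vertex of a longest path is a leaf: another neighbour off the path would
  extend it, and one on the path would close a cycle.\<close>

lemma is_tree_leaf:
  assumes T: "is_tree V E" and fin: "finite V" and card: "2 \<le> card V"
  obtains x m where "x \<in> V" "m \<in> V" "{x, m} \<in> E" "\<And>y. {x, y} \<in> E \<Longrightarrow> y = m"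
proof -
  have E: "E \<subseteq> [V]\<^bsup>2\<^esup>" "graph_connected V E" and nocyc: "\<And>p. \<not> graph_cycle V E p"
    using T by (auto simp: is_tree_def)
  let ?P = "\<lambda>p. distinct p \<and> set p \<subseteq> V \<and> successively (\<lambda>x y. {x, y} \<in> E) p \<and> 2 \<le> length p"
  obtain u v where uv: "u \<in> V" "v \<in> V" "u \<noteq> v"
    using card by (metis One_nat_def Suc_1 card_le_Suc0_iff_eq fin not_less_eq_eq)
  obtain w where w: "w \<in> V" "{u, w} \<in> E"
    using graph_dist_descent[OF E uv] by blast
  have "?P [u, w]" using uv w edge_in[OF E(1) w(2)] by auto
  moreover have "length p < Suc (card V)" if "?P p" for p
    using that fin by (metis card_mono distinct_card le_imp_less_Suc)
  ultimately obtain p where p: "?P p" and max: "\<And>q. ?P q \<Longrightarrow> length q \<le> length p"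
    using ex_has_greatest_nat[of ?P "[u, w]" length "Suc (card V)"] by blast
  obtain a b r where p_eq: "p = a # b # r" using p by (cases p; cases "tl p") auto
  have ab: "{a, b} \<in> E" "a \<in> V" "b \<in> V" using p p_eq by auto
  have "c = b" if c: "{a, c} \<in> E" for c
  proof (rule ccontr)
    assume "c \<noteq> b"
    have cV: "c \<in> V" "c \<noteq> a" using edge_in[OF E(1) c] by auto
    show False
    proof (cases "c \<in> set p")
      case False
      then have "?P (c # p)"
        using p p_eq c cV by (auto simp: insert_commute)
      then show False using max[of "c # p"] by simp
    next
      case True
      then have "c \<in> set r" using p_eq cV \<open>c \<noteq> b\<close> by auto
      then obtain r1 r2 where r: "r = r1 @ c # r2" by (meson split_list)
      define q where "q = a # b # r1 @ [c]"
      have pq: "p = q @ r2" by (simp add: q_def p_eq r)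
      have "successively (\<lambda>x y. {x, y} \<in> E) q" "distinct q" "set q \<subseteq> V"
        using p unfolding pq by (auto simp: successively_append_iff)
      then have "graph_cycle V E q"
        using c by (auto simp: graph_cycle_def walk_betw_def q_def insert_commute)
      then show False using nocyc by blast
    qed
  qed
  then show ?thesis using that ab by blast
qed

lemma is_tree_remove_leaf:
  assumes T: "is_tree V E" and x: "x \<in> V" and m: "m \<in> V" "{x, m} \<in> E"
    and leaf: "\<And>y. {x, y} \<in> E \<Longrightarrow> y = m"
  shows "is_tree (V - {x}) (E - {{x, m}})"
proof -
  have E: "E \<subseteq> [V]\<^bsup>2\<^esup>" "graph_connected V E" and nocyc: "\<And>p. \<not> graph_cycle V E p"
    using T by (auto simp: is_tree_def)
  have "x \<noteq> m" using edge_in[OF E(1) m(2)] by auto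
  have sub: "E - {{x, m}} \<subseteq> [V - {x}]\<^bsup>2\<^esup>"
  proof
    fix e assume e: "e \<in> E - {{x, m}}"
    then obtain y z where yz: "e = {y, z}" "y \<in> V" "z \<in> V" "y \<noteq> z"
      using E(1) unfolding nsets_2_eq by blast
    then have "y \<noteq> x" "z \<noteq> x" using leaf[of z] leaf[of y] e by (auto simp: insert_commute)
    then show "e \<in> [V - {x}]\<^bsup>2\<^esup>" using yz by (auto simp: nsets_def)
  qed
  have "\<exists>w\<in>V - {x}. {u, w} \<in> E - {{x, m}} \<and> Suc (graph_dist V E w v) = graph_dist V E u v"
    if uv: "u \<in> V - {x}" "v \<in> V - {x}" "u \<noteq> v" for u v
  proof -
    obtain w where w: "w \<in> V" "{u, w} \<in> E" "Suc (graph_dist V E w v) = graph_dist V E u v"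
      using graph_dist_descent[OF E, of u v] uv by blast
    \<comment> \<open>A shortest path to another vertex never enters the leaf \<open>x\<close>: it
      would have to return to \<open>m\<close>, which is no closer than before.\<close>
    have "w \<noteq> x"
    proof
      assume "w = x"
      then have "u = m" using leaf[of u] w(2) by (simp add: insert_commute)
      moreover obtain w' where "{x, w'} \<in> E" "Suc (graph_dist V E w' v) = graph_dist V E x v"
        using graph_dist_descent[OF E x, of v] uv by blast
      ultimately show False using leaf w(3) \<open>w = x\<close> by fastforce
    qed
    then show ?thesis using w uv by (intro bexI[of _ w]) (auto simp: doubleton_eq_iff)
  qed
  then have "graph_connected (V - {x}) (E - {{x, m}})"
    unfolding graph_connected_iff
    using walk_of_descent[of "V - {x}" "E - {{x, m}}" "graph_dist V E"] graph_dist_refl[OF E] by blast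
  moreover have "\<not> graph_cycle (V - {x}) (E - {{x, m}}) p" for p
  proof
    assume *: "graph_cycle (V - {x}) (E - {{x, m}}) p"
    have "successively (\<lambda>a b. {a, b} \<in> E) p"
    proof (rule successively_mono)
      show "successively (\<lambda>a b. {a, b} \<in> E - {{x, m}}) p"
        using * by (simp add: graph_cycle_def walk_betw_def)
    qed simp
    then have "graph_cycle V E p" using * by (auto simp: graph_cycle_def walk_betw_def)
    then show False using nocyc by blast
  qed
  ultimately show ?thesis using sub m(1) \<open>x \<noteq> m\<close> by (auto simp: is_tree_def)
qed

lemma is_tree_singleton: "is_tree {v} {}"
proof -
  have "walk_betw {v} {} v [v] v" by (simp add: walk_betw_def)
  moreover have "\<not> graph_cycle {v} {} p" for p by (auto simp: graph_cycle_def)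
  ultimately show ?thesis by (auto simp: is_tree_def graph_connected_def)
qed

lemma tree_induct [consumes 2, case_names singleton leaf]:
  assumes "finite V" "is_tree V E"
    and "\<And>v. P {v} {}"
    and leaf: "\<And>V E x m. finite V \<Longrightarrow> is_tree V E \<Longrightarrow> P V E \<Longrightarrow> x \<notin> V \<Longrightarrow> m \<in> V \<Longrightarrow>
      P (insert x V) (insert {x, m} E)"
  shows "P V E"
  using assms(1,2)
proof (induction "card V" arbitrary: V E rule: less_induct)
  case less
  have E: "E \<subseteq> [V]\<^bsup>2\<^esup>" "V \<noteq> {}" using less.prems by (auto simp: is_tree_def)
  show ?case
  proof (cases "2 \<le> card V")
    case True
    obtain x m where xm: "x \<in> V" "m \<in> V" "{x, m} \<in> E" "\<And>y. {x, y} \<in> E \<Longrightarrow> y = m"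
      using is_tree_leaf[OF less.prems(2,1) True] by metis
    have "m \<in> V - {x}" using edge_in[OF E(1) xm(3)] by auto
    moreover have tree: "is_tree (V - {x}) (E - {{x, m}})"
      by (rule is_tree_remove_leaf[OF less.prems(2) xm])
    moreover have "P (V - {x}) (E - {{x, m}})"
      using less.hyps[OF _ _ tree] less.prems(1) xm(1) by (metis card_Diff1_less finite_Diff)
    ultimately have "P (insert x (V - {x})) (insert {x, m} (E - {{x, m}}))"
      using less.prems(1) by (intro leaf) auto
    then show ?thesis using xm(1,3) by (simp add: insert_absorb)
  next
    case False
    moreover have "card V \<noteq> 0" using E(2) less.prems(1) by simp
    ultimately have "card V = 1" by linarith
    then obtain v where v: "V = {v}" by (metis card_1_singletonE)
    have "E = {}"
    proof (rule ccontr)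
      assume "E \<noteq> {}"
      then obtain y z where "{y, z} \<in> E" using E(1) by (fastforce simp: nsets_def card_2_iff)
      then show False using edge_in[OF E(1)] v by blast
    qed
    then show ?thesis using v assms(3) by simp
  qed
qed

subsection \<open>Distances in trees form tree metrics\<close>

text \<open>Let \<open>\<pi>\<close> contract \<open>x\<close> to \<open>m\<close> and
  \<open>h\<close> record the length of the pendant edge. Then
  \<open>D y z = d (\<pi> y) (\<pi> z) + h y + h z\<close> for distinct \<open>y\<close> and
  \<open>z\<close>, so each inequality follows from that of \<open>d\<close>, apart from coinciding
  vertices.\<close>

lemma (in tree_metric) insert_leaf:
  assumes x: "x \<notin> V" and m: "m \<in> V"
    and D_old: "\<And>y z. y \<in> V \<Longrightarrow> z \<in> V \<Longrightarrow> D y z = d y z"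
    and D_x: "D x x = 0" "\<And>z. z \<in> V \<Longrightarrow> D x z = Suc (d m z)" "\<And>z. z \<in> V \<Longrightarrow> D z x = Suc (d z m)"
  shows "tree_metric (insert x V) D"
proof -
  define \<pi> where "\<pi> y = (if y = x then m else y)" for y
  define h where "h y = (if y = x then 1 else 0 :: nat)" for y
  have \<pi>: "\<pi> y \<in> V" if "y \<in> insert x V" for y using that m by (auto simp: \<pi>_def)
  \<comment> \<open>Only an inequality in general: at \<open>y = z = x\<close> it reads 0 against
    2.\<close>
  have D_le: "D y z \<le> d (\<pi> y) (\<pi> z) + h y + h z" if "y \<in> insert x V" "z \<in> insert x V" for y z
    using that x D_old D_x by (auto simp: \<pi>_def h_def)
  have D_eq: "D y z = d (\<pi> y) (\<pi> z) + h y + h z"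
    if "y \<in> insert x V" "z \<in> insert x V" "y \<noteq> z" for y z
    using that x D_old D_x by (auto simp: \<pi>_def h_def)
  have D_refl: "D y y = 0" if "y \<in> insert x V" for y
    using that D_x D_old zero_iff by auto
  have D_parity: "even (D y z + d (\<pi> y) (\<pi> z) + h y + h z)"
    if "y \<in> insert x V" "z \<in> insert x V" for y z
    using D_eq[OF that] D_refl[OF that(1)] zero_iff[OF \<pi>[OF that(1)] \<pi>[OF that(1)]]
    by (cases "y = z") auto
  have D_sym: "D y z = D z y" if "y \<in> insert x V" "z \<in> insert x V" for y z
    using D_eq[OF that] D_eq[OF that(2,1)] sym[OF \<pi>[OF that(1)] \<pi>[OF that(2)]]
    by (cases "y = z") auto
  show ?thesis
  proof
    fix y z assume yz: "y \<in> insert x V" "z \<in> insert x V"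
    show "D y z = D z y" by (rule D_sym[OF yz])
    show "D y z = 0 \<longleftrightarrow> y = z"
      using yz x D_old D_x zero_iff by auto
  next
    fix a b c assume V: "a \<in> insert x V" "b \<in> insert x V" "c \<in> insert x V"
    show "D a c \<le> D a b + D b c"
    proof (cases "a = b \<or> b = c")
      case True
      then show ?thesis by auto
    next
      case False
      then show ?thesis
        using D_eq[OF V(1,2)] D_eq[OF V(2,3)] D_le[OF V(1,3)] triangle[of "\<pi> a" "\<pi> b" "\<pi> c"] \<pi> V
        by auto
    qed
    show "even (D a b + D b c + D a c)"
      using D_parity[OF V(1,2)] D_parity[OF V(2,3)] D_parity[OF V(1,3)]
        parity[OF \<pi>[OF V(1)] \<pi>[OF V(2)] \<pi>[OF V(3)]] unfolding even_add by argo
  next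
    fix a b c w assume V: "a \<in> insert x V" "b \<in> insert x V" "c \<in> insert x V" "w \<in> insert x V"
    show "D a b + D c w \<le> D a c + D b w \<or> D a b + D c w \<le> D a w + D b c"
    proof (cases "a = c \<or> b = w \<or> a = w \<or> b = c")
      case True
      then show ?thesis using D_sym V by (metis add.commute order_refl)
    next
      case False
      then show ?thesis
        using D_eq[OF V(1,3)] D_eq[OF V(2,4)] D_eq[OF V(1,4)] D_eq[OF V(2,3)]
          D_le[OF V(1,2)] D_le[OF V(3,4)]
          four_point[OF \<pi>[OF V(1)] \<pi>[OF V(2)] \<pi>[OF V(3)] \<pi>[OF V(4)]]
        by linarith
    qed
  next
    fix y z i assume yz: "y \<in> insert x V" "z \<in> insert x V" "i \<le> D y z"
    show "\<exists>w\<in>insert x V. D y w = i \<and> D w z = D y z - i"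
    proof (cases "i = 0 \<or> i = D y z")
      case True
      then show ?thesis using yz D_refl by (metis diff_self_eq_0 diff_zero)
    next
      case False
      consider "y = x" "z = x" | "y = x" "z \<in> V" | "y \<in> V" "z = x" | "y \<in> V" "z \<in> V"
        using yz by blast
      then show ?thesis
      proof cases
        case 1
        then show ?thesis using yz(3) False D_x by simp
      next
        case 2
        then obtain j where "i = Suc j" "j \<le> d m z" using False yz(3) D_x by (cases i) auto
        then obtain w where "w \<in> V" "d m w = j" "d w z = d m z - j"
          using between[OF m 2(2), of j] by blast
        then show ?thesis using 2 \<open>i = Suc j\<close> D_x D_old by auto
      next
        case 3
        then have "i \<le> d y m" using False yz(3) D_x by auto
        then obtain w where "w \<in> V" "d y w = i" "d w m = d y m - i"
          using between[OF 3(1) m, of i] by blast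
        then show ?thesis using 3 \<open>i \<le> d y m\<close> D_x D_old by auto
      next
        case 4
        then show ?thesis using between[of y z i] yz(3) D_old by auto
      qed
    qed
  qed
qed

lemma is_treeD: "is_tree V E \<Longrightarrow> E \<subseteq> [V]\<^bsup>2\<^esup> \<and> graph_connected V E"
  by (simp add: is_tree_def)

lemma tree_dist_insert_leaf:
  assumes "is_tree V E" "x \<notin> V" "m \<in> V"
  defines "d \<equiv> graph_dist V E" and "D \<equiv> graph_dist (insert x V) (insert {x, m} E)"
  shows "\<And>y z. y \<in> V \<Longrightarrow> z \<in> V \<Longrightarrow> D y z = d y z"
    and "D x x = 0"
    and "\<And>z. z \<in> V \<Longrightarrow> D x z = Suc (d m z)"
    and "\<And>z. z \<in> V \<Longrightarrow> D z x = Suc (d z m)"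
  using graph_dist_insert_leaf(3)[of E V x m] is_treeD[OF assms(1)] assms(2,3)
  by (auto simp: d_def D_def)

theorem tree_metric_graph_dist:
  assumes "finite V" "is_tree V E"
  shows "tree_metric V (graph_dist V E)"
  using assms
proof (induction rule: tree_induct)
  case (singleton v)
  have "graph_dist {v} {} v v = 0"
    using graph_dist_refl[of "{}" "{v}" v] is_tree_singleton[of v] by (auto simp: is_tree_def)
  then show ?case by unfold_locales auto
next
  case (leaf V E x m)
  then show ?case
    by (intro tree_metric.insert_leaf[of V "graph_dist V E" x m]) (auto simp: tree_dist_insert_leaf)
qed

lemma edge_iff_dist_1:
  assumes "finite V" "is_tree V E" "u \<in> V" "v \<in> V"
  shows "{u, v} \<in> E \<longleftrightarrow> graph_dist V E u v = 1"
proof -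
  interpret tree_metric V "graph_dist V E" using assms by (intro tree_metric_graph_dist)
  have E: "E \<subseteq> [V]\<^bsup>2\<^esup>" "graph_connected V E" using is_treeD assms by auto
  show ?thesis
  proof
    assume "{u, v} \<in> E"
    then have "graph_dist V E u v \<le> 1" "u \<noteq> v"
      using graph_dist_edge_le[OF E, of u v v] graph_dist_refl[OF E assms(4)] edge_in[OF E(1)]
        assms(4) by auto
    then show "graph_dist V E u v = 1" using zero_iff[OF assms(3,4)] by linarith
  next
    assume "graph_dist V E u v = 1"
    then show "{u, v} \<in> E"
      using graph_dist_walk[OF E assms(3,4)] by (auto simp: walk_of_length_Suc walk_of_length_0)
  qed
qed

section \<open>Stars and the ambiguous pair of trees\<close>

lemma star_tree:
  assumes "finite S" "m \<notin> S"
  shows "is_tree (insert m S) ((\<lambda>x. {x, m}) ` S) \<and>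
    (\<forall>y\<in>insert m S. \<forall>z\<in>insert m S. graph_dist (insert m S) ((\<lambda>x. {x, m}) ` S) y z =
      (if y = z then 0 else if y = m \<or> z = m then 1 else 2))"
  using assms
proof (induction rule: finite_induct)
  case empty
  have "graph_dist {m} {} m m = 0"
    using graph_dist_refl[of "{}" "{m}" m] is_tree_singleton[of m] by (auto simp: is_tree_def)
  then show ?case by (simp add: is_tree_singleton)
next
  case (insert x S)
  let ?V = "insert m S" and ?E = "(\<lambda>x. {x, m}) ` S"
  have x: "x \<notin> ?V" and IH: "is_tree ?V ?E"
    "\<And>y z. y \<in> ?V \<Longrightarrow> z \<in> ?V \<Longrightarrow> graph_dist ?V ?E y z =
      (if y = z then 0 else if y = m \<or> z = m then 1 else 2)"
    using insert by auto
  have eqs: "insert m (insert x S) = insert x ?V" "(\<lambda>x. {x, m}) ` insert x S = insert {x, m} ?E"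
    by auto
  have "graph_dist (insert x ?V) (insert {x, m} ?E) y z =
      (if y = z then 0 else if y = m \<or> z = m then 1 else 2)"
    if "y \<in> insert x ?V" "z \<in> insert x ?V" for y z
    using that
  proof (elim insertE[of _ x])
    assume "y = x" "z = x"
    then show ?thesis using tree_dist_insert_leaf(2)[OF IH(1) x, of m] by simp
  next
    assume "y = x" "z \<in> ?V"
    then show ?thesis using tree_dist_insert_leaf(3)[OF IH(1) x, of m z] IH(2)[of m z] x by auto
  next
    assume "y \<in> ?V" "z = x"
    then show ?thesis using tree_dist_insert_leaf(4)[OF IH(1) x, of m y] IH(2)[of y m] x by auto
  next
    assume "y \<in> ?V" "z \<in> ?V"
    then show ?thesis using tree_dist_insert_leaf(1)[OF IH(1) x, of m y z] IH(2)[of y z] by auto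
  qed
  then show ?case
    unfolding eqs using is_tree_insert_leaf[OF IH(1) x, of m] by blast
qed

text \<open>In both trees \<open>c\<close> is at distance 2 from \<open>m\<close> and 3 from the
  other star leaves. Its distances to \<open>a1\<close>, \<open>a2\<close>, \<open>a3\<close> are 1,
  3, 4 if it hangs from \<open>a1\<close> and 3, 1, 2 if it hangs from \<open>a2\<close>.\<close>

lemma ambiguous_trees:
  assumes fin: "finite V" and V: "c \<in> V" "a1 \<in> V" "a2 \<in> V" "a3 \<in> V" "m \<in> V"
    and dist: "distinct [c, a1, a2, a3, m]"
  obtains T1 T2 where "is_tree V T1" "is_tree V T2"
    "\<forall>x\<in>V. \<forall>y\<in>V. \<not> (x = c \<and> y \<in> {a1, a2, a3}) \<and> \<not> (y = c \<and> x \<in> {a1, a2, a3}) \<longrightarrow>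
      graph_dist V T1 x y = graph_dist V T2 x y"
    "\<forall>x\<in>V. \<forall>y\<in>V. graph_dist V T1 x y = 4 \<longleftrightarrow> {x, y} = {c, a3}"
    "\<forall>x\<in>V. \<forall>y\<in>V. graph_dist V T1 x y \<le> 4"
    "\<forall>x\<in>V. \<forall>y\<in>V. graph_dist V T2 x y \<le> 3"
    "graph_dist V T2 c a1 = 3" "graph_dist V T2 c a3 = 2" "graph_dist V T2 a3 c = 2"
proof -
  define S where "S = V - {c, a3, m}"
  define U where "U = insert m S"
  define F where "F = (\<lambda>x. {x, m}) ` S"
  define s where "s = graph_dist U F"
  have "finite S" "m \<notin> S" using fin by (auto simp: S_def)
  then have F: "is_tree U F"
    and s: "\<And>y z. y \<in> U \<Longrightarrow> z \<in> U \<Longrightarrow> s y z = (if y = z then 0 else if y = m \<or> z = m then 1 else 2)"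
    using star_tree[of S m] by (auto simp: U_def F_def s_def)
  have U: "U = V - {c, a3}" using V dist by (auto simp: U_def S_def)
  have inU: "a1 \<in> U" "a2 \<in> U" "m \<in> U" "a3 \<notin> U" "c \<notin> U" using V dist by (auto simp: U)
  define T0 where "T0 = insert {a3, a2} F"
  define d0 where "d0 = graph_dist (insert a3 U) T0"
  have T0: "is_tree (insert a3 U) T0"
    unfolding T0_def by (rule is_tree_insert_leaf[OF F]) (use inU in auto)
  note d0 = tree_dist_insert_leaf[OF F inU(4,2), folded T0_def d0_def s_def]
  have c: "c \<notin> insert a3 U" using inU dist by auto
  have V_eq: "insert c (insert a3 U) = V" using V by (auto simp: U)
  define T1 where "T1 = insert {c, a1} T0"
  define T2 where "T2 = insert {c, a2} T0"
  have in0: "a1 \<in> insert a3 U" "a2 \<in> insert a3 U" using inU by auto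
  have tree: "is_tree V T1" "is_tree V T2"
    using is_tree_insert_leaf[OF T0 c in0(1)] is_tree_insert_leaf[OF T0 c in0(2)]
    by (simp_all add: V_eq T1_def T2_def)
  note d1 = tree_dist_insert_leaf[OF T0 c in0(1), folded d0_def, unfolded V_eq, folded T1_def]
  note d2 = tree_dist_insert_leaf[OF T0 c in0(2), folded d0_def, unfolded V_eq, folded T2_def]
  have ne: "c \<noteq> a1" "c \<noteq> a2" "c \<noteq> a3" "a1 \<noteq> a2" "a1 \<noteq> a3" "a2 \<noteq> a3" "m \<noteq> c" "m \<noteq> a1"
    "m \<noteq> a2" "m \<noteq> a3" "a1 \<noteq> m" "a2 \<noteq> m" "a3 \<noteq> m" "a3 \<noteq> a2" "a3 \<noteq> a1" "a2 \<noteq> a1" "a3 \<noteq> c"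
    using dist by auto
  \<comment> \<open>The stages of the construction: the star on \<open>U\<close>, then
    \<open>a3\<close>, then \<open>c\<close>.\<close>
  have sc: "x \<in> U \<and> x \<noteq> c \<and> x \<noteq> a3 \<or> x = a3 \<or> x = c" if "x \<in> V" for x
    using that by (auto simp: U)
  show ?thesis
  proof (rule that[OF tree])
    show "graph_dist V T2 c a1 = 3" "graph_dist V T2 c a3 = 2" "graph_dist V T2 a3 c = 2"
      by (simp_all add: d2 d0 s inU ne)
    show "\<forall>x\<in>V. \<forall>y\<in>V. graph_dist V T1 x y \<le> 4"
      by (intro ballI; drule sc; drule sc; elim disjE) (simp_all add: d1 d0 s inU ne)
    show "\<forall>x\<in>V. \<forall>y\<in>V. graph_dist V T2 x y \<le> 3"
      by (intro ballI; drule sc; drule sc; elim disjE) (simp_all add: d2 d0 s inU ne)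
    show "\<forall>x\<in>V. \<forall>y\<in>V. graph_dist V T1 x y = 4 \<longleftrightarrow> {x, y} = {c, a3}"
      by (intro ballI; drule sc; drule sc; elim disjE) (simp_all add: d1 d0 s inU ne doubleton_eq_iff)
    show "\<forall>x\<in>V. \<forall>y\<in>V. \<not> (x = c \<and> y \<in> {a1, a2, a3}) \<and> \<not> (y = c \<and> x \<in> {a1, a2, a3}) \<longrightarrow>
      graph_dist V T1 x y = graph_dist V T2 x y"
      by (intro ballI; drule sc; drule sc; elim disjE) (auto simp: d1 d2 d0 s inU ne)
  qed
qed

subsection \<open>Query graphs\<close>

lemma graph_diam:
  assumes "finite V" "V \<noteq> {}"
  shows "x \<in> V \<Longrightarrow> y \<in> V \<Longrightarrow> graph_dist V E x y \<le> graph_diam V E"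
    and "\<exists>x\<in>V. \<exists>y\<in>V. graph_dist V E x y = graph_diam V E"
proof -
  let ?S = "{graph_dist V E u v | u v. u \<in> V \<and> v \<in> V}"
  have "?S = (\<lambda>(u, v). graph_dist V E u v) ` (V \<times> V)" by auto
  then have S: "finite ?S" "?S \<noteq> {}" using assms by auto
  show "graph_dist V E x y \<le> graph_diam V E" if "x \<in> V" "y \<in> V"
    unfolding graph_diam_def using S(1) that by (intro Max_ge) auto
  show "\<exists>x\<in>V. \<exists>y\<in>V. graph_dist V E x y = graph_diam V E"
    using Max_in[OF S] unfolding graph_diam_def by force
qed

section \<open>Degrees and numbers of queries\<close>

lemma graph_degree_eq:
  assumes "query_graph V Q"
  shows "graph_degree Q v = card {x \<in> V. {v, x} \<in> Q}"
proof -
  have Q: "Q \<subseteq> [V]\<^bsup>2\<^esup>" using assms by (simp add: query_graph_def)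
  have "{e \<in> Q. v \<in> e} = (\<lambda>x. {v, x}) ` {x \<in> V. {v, x} \<in> Q}"
    using Q by (fastforce simp: nsets_2_eq insert_commute)
  moreover have "inj_on (\<lambda>x. {v, x}) {x \<in> V. {v, x} \<in> Q}"
    by (auto simp: inj_on_def doubleton_eq_iff)
  ultimately show ?thesis by (simp add: graph_degree_def card_image)
qed

lemma card_unqueried:
  assumes "query_graph V Q" "finite V" "v \<in> V"
  shows "card {x \<in> V. x \<noteq> v \<and> {v, x} \<notin> Q} + graph_degree Q v + 1 = card V"
proof -
  let ?H = "{x \<in> V. x \<noteq> v \<and> {v, x} \<notin> Q}" and ?N = "{x \<in> V. {v, x} \<in> Q}"
  have "v \<notin> ?N" using assms(1) edge_in[of Q V v v] by (auto simp: query_graph_def)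
  then have "V = insert v (?H \<union> ?N)" "v \<notin> ?H \<union> ?N" "?H \<inter> ?N = {}" using assms(3) by auto
  then have "card V = Suc (card ?H + card ?N)"
    using assms(2) card_insert_disjoint[of "?H \<union> ?N" v] card_Un_disjoint[of ?H ?N] by auto
  then show ?thesis using graph_degree_eq[OF assms(1)] by simp
qed

lemma handshake:
  assumes "query_graph V Q" "finite V"
  shows "(\<Sum>v\<in>V. graph_degree Q v) = 2 * card Q"
proof -
  have Q: "Q \<subseteq> [V]\<^bsup>2\<^esup>" using assms by (simp add: query_graph_def)
  have "finite Q" using Q assms(2) finite_imp_finite_nsets finite_subset by metis
  moreover have "card {v \<in> V. v \<in> e} = 2" if "e \<in> Q" for e
  proof -
    have "{v \<in> V. v \<in> e} = e" "card e = 2" using Q that by (auto simp: nsets_def)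
    then show ?thesis by simp
  qed
  ultimately show ?thesis
    unfolding graph_degree_def using assms(2) by (intro sum_multicount) auto
qed

text \<open>The complement of a Hamilton cycle: in a cyclic numbering of \<open>V\<close> every
  vertex misses only itself, its successor and its predecessor.\<close>

lemma exists_regular_query_graph:
  assumes "finite V" "card V = n" "3 \<le> n"
  shows "\<exists>Q. query_graph V Q \<and> (\<forall>v\<in>V. graph_degree Q v = n - 3)"
proof -
  obtain f where f: "bij_betw f {0..<n} V" using ex_bij_betw_nat_finite[OF assms(1)] assms(2) by blast
  define nxt where "nxt i = (if Suc i = n then 0 else Suc i)" for i
  define prv where "prv i = (if i = 0 then n - 1 else i - 1)" for i
  define Q where "Q = {{f i, f j} | i j. i < n \<and> j < n \<and> i \<noteq> j \<and> j \<noteq> nxt i \<and> i \<noteq> nxt j}"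
  have inj: "f i = f j \<longleftrightarrow> i = j" if "i < n" "j < n" for i j
    using f that by (auto simp: bij_betw_def inj_on_def)
  have fV: "f i \<in> V" if "i < n" for i using f that by (auto simp: bij_betw_def)
  have Q: "query_graph V Q"
    unfolding query_graph_def Q_def using fV inj by auto
  have "graph_degree Q v = n - 3" if v: "v \<in> V" for v
  proof -
    obtain i where i: "i < n" "v = f i" using f v by (auto simp: bij_betw_def)
    have np: "nxt i < n" "prv i < n" "nxt i \<noteq> i" "prv i \<noteq> i" "nxt i \<noteq> prv i"
      using i assms(3) by (auto simp: nxt_def prv_def)
    have prv: "i = nxt j \<longleftrightarrow> j = prv i" if "j < n" for j
      using i that assms(3) by (auto simp: nxt_def prv_def)
    have edge: "{f i, f j} \<in> Q \<longleftrightarrow> j \<noteq> i \<and> j \<noteq> nxt i \<and> j \<noteq> prv i" if "j < n" for j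
    proof -
      have "{f i, f j} \<in> Q \<longleftrightarrow> i \<noteq> j \<and> j \<noteq> nxt i \<and> i \<noteq> nxt j"
        unfolding Q_def using i that by (auto simp: doubleton_eq_iff inj)
      then show ?thesis using prv[OF that] by auto
    qed
    have "{x \<in> V. {v, x} \<in> Q} = f ` ({0..<n} - {i, nxt i, prv i})"
    proof -
      have "V = f ` {0..<n}" using f by (simp add: bij_betw_def)
      then show ?thesis using edge i by auto
    qed
    moreover have "inj_on f ({0..<n} - {i, nxt i, prv i})"
      using f by (auto simp: bij_betw_def intro: inj_on_subset)
    moreover have "card ({0..<n} - {i, nxt i, prv i}) = n - 3"
      using i np by (subst card_Diff_subset) auto
    ultimately show ?thesis using graph_degree_eq[OF Q] by (simp add: card_image)
  qed
  then show ?thesis using Q by blast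
qed

section \<open>Failure at a vertex of low degree\<close>

lemma graph_iso_dist_le:
  assumes iso: "bij_betw f V V" "\<forall>u\<in>V. \<forall>v\<in>V. {u, v} \<in> E \<longleftrightarrow> {f u, f v} \<in> F"
    and E: "E \<subseteq> [V]\<^bsup>2\<^esup>" "graph_connected V E" and uv: "u \<in> V" "v \<in> V"
  shows "graph_dist V F (f u) (f v) \<le> graph_dist V E u v"
proof -
  have fV: "f x \<in> V" if "x \<in> V" for x using iso(1) that by (auto simp: bij_betw_def)
  have "walk_of_length V F k (f u) (f v)" if "walk_of_length V E k u v" for k
    using that
  proof (induction k arbitrary: u)
    case 0
    then show ?case using fV by (auto simp: walk_of_length_0)
  next
    case (Suc k)
    then obtain w where w: "{u, w} \<in> E" "walk_of_length V E k w v" by (auto simp: walk_of_length_Suc)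
    then show ?case using Suc.IH[OF w(2)] iso(2) edge_in[OF E(1) w(1)] fV
      by (auto simp: walk_of_length_Suc)
  qed
  then show ?thesis
    unfolding graph_dist_Least[of V F] by (intro Least_le) (use graph_dist_walk[OF E uv] in blast)
qed

lemma low_degree_fails:
  assumes fin: "finite V" and large: "5 \<le> card V" and Q: "query_graph V Q"
    and c: "c \<in> V" "graph_degree Q c < card V - 3"
  shows "\<not> finds_diametral_pair V Q \<and> \<not> determines_tree_up_to_iso V Q"
proof -
  let ?H = "{x \<in> V. x \<noteq> c \<and> {c, x} \<notin> Q}"
  have "3 \<le> card ?H" using card_unqueried[OF Q fin c(1)] c(2) by linarith
  then obtain A where A: "A \<subseteq> ?H" "card A = 3" by (meson obtain_subset_with_card_n)
  then obtain a1 a2 a3 where a: "A = {a1, a2, a3}" "a1 \<noteq> a2" "a1 \<noteq> a3" "a2 \<noteq> a3"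
    by (auto simp: card_3_iff)
  \<comment> \<open>A fifth vertex is required as the centre \<open>m\<close> of the star.\<close>
  have "card {c, a1, a2, a3} \<le> 4" by (simp add: card_insert_if)
  then have "\<not> V \<subseteq> {c, a1, a2, a3}"
    using card_mono[of "{c, a1, a2, a3}" V] large by auto
  then obtain m where m: "m \<in> V" "m \<notin> {c, a1, a2, a3}" by blast
  have V: "a1 \<in> V" "a2 \<in> V" "a3 \<in> V" and dist: "distinct [c, a1, a2, a3, m]"
    and unq: "{c, a1} \<notin> Q" "{c, a2} \<notin> Q" "{c, a3} \<notin> Q"
    using A a m by auto
  obtain T1 T2 where T: "is_tree V T1" "is_tree V T2"
    and agree: "\<forall>x\<in>V. \<forall>y\<in>V. \<not> (x = c \<and> y \<in> {a1, a2, a3}) \<and> \<not> (y = c \<and> x \<in> {a1, a2, a3}) \<longrightarrow>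
      graph_dist V T1 x y = graph_dist V T2 x y"
    and d1: "\<forall>x\<in>V. \<forall>y\<in>V. graph_dist V T1 x y = 4 \<longleftrightarrow> {x, y} = {c, a3}"
      "\<forall>x\<in>V. \<forall>y\<in>V. graph_dist V T1 x y \<le> 4"
    and d2: "\<forall>x\<in>V. \<forall>y\<in>V. graph_dist V T2 x y \<le> 3"
      "graph_dist V T2 c a1 = 3" "graph_dist V T2 c a3 = 2" "graph_dist V T2 a3 c = 2"
    by (rule ambiguous_trees[OF fin c(1) V m(1) dist])
  have "graph_dist V T2 u v = graph_dist V T1 u v" if "{u, v} \<in> Q" for u v
  proof -
    have "u \<in> V" "v \<in> V" using edge_in[of Q V u v] Q that by (auto simp: query_graph_def)
    moreover have "\<not> (u = c \<and> v \<in> {a1, a2, a3})" "\<not> (v = c \<and> u \<in> {a1, a2, a3})"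
      using that unq by (auto simp: insert_commute)
    ultimately show ?thesis using agree by simp
  qed
  then have cons: "consistent V Q T1 T1" "consistent V Q T1 T2"
    using T by (auto simp: consistent_def)
  have "\<not> finds_diametral_pair V Q"
  proof
    assume "finds_diametral_pair V Q"
    then obtain x y where xy: "x \<in> V" "y \<in> V"
      and diam: "\<And>T'. consistent V Q T1 T' \<Longrightarrow> graph_dist V T' x y = graph_diam V T'"
      unfolding finds_diametral_pair_def using T(1) by blast
    \<comment> \<open>The pair must attain 4 in \<open>T1\<close>, hence is \<open>{c, a3}\<close>;
      but in \<open>T2\<close> its distance is 2, below the distance 3 of \<open>c\<close> and
      \<open>a1\<close>.\<close>
    have "graph_dist V T1 c a3 \<le> graph_dist V T1 x y"
      using graph_diam(1)[OF fin _ c(1) V(3)] c(1) diam[OF cons(1)] by auto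
    then have "graph_dist V T1 x y = 4" using d1 c(1) V(3) xy by (metis le_antisym)
    then have "{x, y} = {c, a3}" using d1(1) xy by simp
    then have "graph_dist V T2 x y = 2" using d2 by (auto simp: doubleton_eq_iff)
    moreover have "3 \<le> graph_dist V T2 x y"
      using graph_diam(1)[OF fin _ c(1) V(1), of T2] c(1) diam[OF cons(2)] d2(2) by auto
    ultimately show False by simp
  qed
  moreover have "\<not> determines_tree_up_to_iso V Q"
  proof
    assume "determines_tree_up_to_iso V Q"
    then have "graph_iso V T2 V T1"
      unfolding determines_tree_up_to_iso_def using T(1) cons by blast
    then obtain f where f: "bij_betw f V V" "\<forall>u\<in>V. \<forall>v\<in>V. {u, v} \<in> T2 \<longleftrightarrow> {f u, f v} \<in> T1"
      by (auto simp: graph_iso_def)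
    \<comment> \<open>The preimages of \<open>c\<close> and \<open>a3\<close> would have distance at
      least 4 in \<open>T2\<close>, where distances are at most 3.\<close>
    obtain x y where "x \<in> V" "f x = c" "y \<in> V" "f y = a3"
      using f(1) c(1) V(3) unfolding bij_betw_def by (metis imageE)
    then have "graph_dist V T1 c a3 \<le> 3"
      using graph_iso_dist_le[OF f, of x y] is_treeD[OF T(2)] d2(1) by fastforce
    moreover have "graph_dist V T1 c a3 = 4" using d1(1) c(1) V(3) by blast
    ultimately show False by simp
  qed
  ultimately show ?thesis by blast
qed

section \<open>Success when all degrees are high\<close>

lemma consistent_metric_pair:
  assumes fin: "finite V" and large: "13 \<le> card V" and Q: "query_graph V Q"
    and deg: "\<forall>v\<in>V. card V - 3 \<le> graph_degree Q v"
    and T: "is_tree V T'" "is_tree V T''"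
    and agree: "\<And>u v. {u, v} \<in> Q \<Longrightarrow> graph_dist V T' u v = graph_dist V T'' u v"
  shows "tree_metric_pair V (graph_dist V T') (graph_dist V T'')"
proof (intro tree_metric_pair.intro tree_metric_pair_axioms.intro)
  show "tree_metric V (graph_dist V T')" "tree_metric V (graph_dist V T'')"
    using tree_metric_graph_dist fin T by auto
  fix u assume u: "u \<in> V"
  let ?D = "{x \<in> V. graph_dist V T' u x \<noteq> graph_dist V T'' u x}"
  \<comment> \<open>A disagreement is an unqueried pair, and the degree bound leaves at most two of
    these at each vertex.\<close>
  have "?D \<subseteq> {x \<in> V. x \<noteq> u \<and> {u, x} \<notin> Q}"
  proof (intro subsetI CollectI conjI notI)
    fix x assume x: "x \<in> ?D"
    show "x \<in> V" using x by simp
    show False if "x = u"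
      using x that graph_dist_refl[of T' V u] graph_dist_refl[of T'' V u] is_treeD[OF T(1)]
        is_treeD[OF T(2)] u by simp
    show False if "{u, x} \<in> Q" using x agree[OF that] by simp
  qed
  then have "card ?D \<le> card {x \<in> V. x \<noteq> u \<and> {u, x} \<notin> Q}" using fin by (intro card_mono) auto
  moreover have "card V - 3 \<le> graph_degree Q u" using deg u by blast
  ultimately show "card ?D \<le> 2"
    using card_unqueried[OF Q fin u] by linarith
qed (use fin large in auto)

lemma high_degree_determines:
  assumes fin: "finite V" and large: "13 \<le> card V" and Q: "query_graph V Q"
    and deg: "\<forall>v\<in>V. card V - 3 \<le> graph_degree Q v"
  shows "determines_tree_up_to_iso V Q"
  unfolding determines_tree_up_to_iso_def
proof (intro allI impI)
  fix T T' T'' assume "is_tree V T" and cons: "consistent V Q T T' \<and> consistent V Q T T''"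
  then have T: "is_tree V T'" "is_tree V T''" by (auto simp: consistent_def)
  have "tree_metric_pair V (graph_dist V T') (graph_dist V T'')"
    using cons by (intro consistent_metric_pair[OF assms T]) (auto simp: consistent_def)
  then obtain \<sigma> where \<sigma>: "bij_betw \<sigma> V V"
    "\<forall>x\<in>V. \<forall>y\<in>V. graph_dist V T'' (\<sigma> x) (\<sigma> y) = graph_dist V T' x y"
    using tree_metrics_isometric by blast
  \<comment> \<open>Edges are the pairs at distance 1, so an isometry is an isomorphism.\<close>
  have "{u, v} \<in> T' \<longleftrightarrow> {\<sigma> u, \<sigma> v} \<in> T''" if "u \<in> V" "v \<in> V" for u v
    using edge_iff_dist_1[OF fin T(1) that] edge_iff_dist_1[OF fin T(2), of "\<sigma> u" "\<sigma> v"] \<sigma> that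
    by (auto simp: bij_betw_def)
  then show "graph_iso V T' V T''" unfolding graph_iso_def using \<sigma>(1) by blast
qed

lemma graph_diam_isometric:
  assumes fin: "finite V" and ne: "V \<noteq> {}" and bij: "bij_betw \<sigma> V V"
    and iso: "\<forall>x\<in>V. \<forall>y\<in>V. graph_dist V T' (\<sigma> x) (\<sigma> y) = graph_dist V T x y"
  shows "graph_diam V T' = graph_diam V T"
proof (rule antisym)
  obtain u v where uv: "u \<in> V" "v \<in> V" "graph_dist V T' u v = graph_diam V T'"
    using graph_diam(2)[OF fin ne, of T'] by blast
  obtain x y where xy: "x \<in> V" "y \<in> V" "\<sigma> x = u" "\<sigma> y = v"
    using bij uv unfolding bij_betw_def by (metis imageE)
  then show "graph_diam V T' \<le> graph_diam V T"
    using graph_diam(1)[OF fin ne xy(1,2), of T] iso uv(3) by metis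
  obtain x y where xy: "x \<in> V" "y \<in> V" "graph_dist V T x y = graph_diam V T"
    using graph_diam(2)[OF fin ne, of T] by blast
  moreover have "\<sigma> x \<in> V" "\<sigma> y \<in> V" using bij xy by (auto simp: bij_betw_def)
  ultimately show "graph_diam V T \<le> graph_diam V T'"
    using graph_diam(1)[OF fin ne, of "\<sigma> x" "\<sigma> y" T'] iso by simp
qed

text \<open>At most four vertices are unqueried against \<open>x\<close> or \<open>y\<close>.
  Avoiding them, \<open>far_unchanged_pair\<close> still finds a vertex far enough from one of the
  two, and that pair is queried.\<close>

lemma shrinking_pair_queried:
  assumes fin: "finite V" and large: "13 \<le> card V" and Q: "query_graph V Q"
    and deg: "\<forall>v\<in>V. card V - 3 \<le> graph_degree Q v"
    and pair: "tree_metric_pair V d e"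
    and xy: "x \<in> V" "y \<in> V" "e x y < d x y"
  shows "\<exists>u\<in>V. \<exists>v\<in>V. {u, v} \<in> Q \<and> d x y \<le> d u v"
proof -
  let ?H = "\<lambda>v. {x \<in> V. x \<noteq> v \<and> {v, x} \<notin> Q}"
  have H: "card (?H v) \<le> 2" if "v \<in> V" for v
    using card_unqueried[OF Q fin that] deg that large by fastforce
  have "card (?H x \<union> ?H y) \<le> 4"
    using card_Un_le[of "?H x" "?H y"] H[OF xy(1)] H[OF xy(2)] by linarith
  moreover have "finite (?H x \<union> ?H y)" using fin by simp
  ultimately obtain z where z: "z \<in> V - {x, y} - (?H x \<union> ?H y)" "d x y \<le> d x z \<or> d x y \<le> d y z"
    using tree_metric_pair.far_unchanged_pair[OF pair xy] by blast
  then have "z \<in> V" "{x, z} \<in> Q" "{y, z} \<in> Q" by auto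
  then show ?thesis using z(2) xy(1,2) by blast
qed

lemma high_degree_finds:
  assumes fin: "finite V" and large: "13 \<le> card V" and Q: "query_graph V Q"
    and deg: "\<forall>v\<in>V. card V - 3 \<le> graph_degree Q v"
  shows "finds_diametral_pair V Q"
  unfolding finds_diametral_pair_def
proof (intro allI impI)
  fix T assume T: "is_tree V T"
  have ne: "V \<noteq> {}" using large by auto
  have pair: "tree_metric_pair V (graph_dist V T) (graph_dist V T')" if "consistent V Q T T'" for T'
    using that by (intro consistent_metric_pair[OF assms T]) (auto simp: consistent_def)
  have diam: "graph_diam V T' = graph_diam V T" if "consistent V Q T T'" for T'
    using tree_metrics_isometric[OF pair[OF that]] graph_diam_isometric[OF fin ne] by blast
  show "\<exists>x\<in>V. \<exists>y\<in>V. \<forall>T'. consistent V Q T T' \<longrightarrow> graph_dist V T' x y = graph_diam V T'"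
  proof (cases "\<exists>x\<in>V. \<exists>y\<in>V. {x, y} \<in> Q \<and> graph_dist V T x y = graph_diam V T")
    case True
    then obtain x y where "x \<in> V" "y \<in> V" "{x, y} \<in> Q" "graph_dist V T x y = graph_diam V T" by blast
    then show ?thesis using diam by (intro bexI[of _ x] bexI[of _ y]) (auto simp: consistent_def)
  next
    case False
    obtain x y where xy: "x \<in> V" "y \<in> V" "graph_dist V T x y = graph_diam V T"
      using graph_diam(2)[OF fin ne] by blast
    \<comment> \<open>If the pair could shrink, some queried pair would be at least as far apart and
      hence diametral, against the case assumption.\<close>
    have "\<not> graph_dist V T' x y < graph_dist V T x y" if "consistent V Q T T'" for T'
      using shrinking_pair_queried[OF assms pair[OF that] xy(1,2)] False xy(3)
        graph_diam(1)[OF fin ne, of _ _ T] by (metis le_antisym)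
    \<comment> \<open>Consistent trees are isometric and share the diameter, so the pair cannot grow
      either.\<close>
    moreover have "graph_dist V T' x y \<le> graph_diam V T" if "consistent V Q T T'" for T'
      using graph_diam(1)[OF fin ne xy(1,2), of T'] diam[OF that] by simp
    ultimately have "graph_dist V T' x y = graph_diam V T'" if "consistent V Q T T'" for T'
      using that diam[OF that] xy(3) by (metis le_antisym not_less)
    then show ?thesis using xy by blast
  qed
qed

theorem theorem2p4:
  fixes V :: "'a set" and n :: nat
  assumes "finite V" and "card V = n" and "n \<ge> 13"
  shows "is_min_queries V finds_diametral_pair (n * (n - 3) div 2) \<and>
         is_min_queries V determines_tree_up_to_iso (n * (n - 3) div 2) \<and>
         (\<forall>Q. query_graph V Q \<longrightarrow>
            (finds_diametral_pair V Q \<longleftrightarrow> determines_tree_up_to_iso V Q) \<and>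
            (determines_tree_up_to_iso V Q \<longleftrightarrow> (\<forall>v\<in>V. n - 3 \<le> graph_degree Q v)))"
proof -
  have iff: "finds_diametral_pair V Q \<longleftrightarrow> (\<forall>v\<in>V. n - 3 \<le> graph_degree Q v)"
    "determines_tree_up_to_iso V Q \<longleftrightarrow> (\<forall>v\<in>V. n - 3 \<le> graph_degree Q v)"
    if Q: "query_graph V Q" for Q
    using high_degree_finds[OF assms(1) _ Q] high_degree_determines[OF assms(1) _ Q]
      low_degree_fails[OF assms(1) _ Q] assms(2,3) by (auto simp: not_le[symmetric])
  \<comment> \<open>Both properties amount to the same degree condition, so the minimum is computed
    once for any such property.\<close>
  have min: "is_min_queries V P (n * (n - 3) div 2)"
    if P: "\<And>Q. query_graph V Q \<Longrightarrow> P V Q \<longleftrightarrow> (\<forall>v\<in>V. n - 3 \<le> graph_degree Q v)"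
    for P :: "'a set \<Rightarrow> 'a set set \<Rightarrow> bool"
  proof -
    obtain Q where Q: "query_graph V Q" "\<forall>v\<in>V. graph_degree Q v = n - 3"
      using exists_regular_query_graph[OF assms(1,2)] assms(3) by auto
    \<comment> \<open>The degree sum also shows that \<open>n * (n - 3)\<close> is even, so the
      division by 2 is exact.\<close>
    then have "n * (n - 3) = 2 * card Q" using handshake[OF Q(1) assms(1)] assms(2) by simp
    then have "P V Q \<and> card Q = n * (n - 3) div 2" using P[OF Q(1)] Q(2) by simp
    moreover have "n * (n - 3) div 2 \<le> card R" if R: "query_graph V R" "P V R" for R
    proof -
      have "n * (n - 3) \<le> (\<Sum>v\<in>V. graph_degree R v)"
        using sum_bounded_below[of V "n - 3" "graph_degree R"] P R assms(2) by auto
      then show ?thesis using handshake[OF R(1) assms(1)] by simp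
    qed
    ultimately show ?thesis unfolding is_min_queries_def using Q(1) by blast
  qed
  show ?thesis using iff min[of finds_diametral_pair] min[of determines_tree_up_to_iso] by simp
qed

end
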